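(* Let $Y$ be the complement of a knot $K$ in an integer homology 3-sphere $\hat Y$, and let $Y_{p/r}$ be the result of Dehn surgery along $K$ with coefficient $p/r\in\mathbb Q^*$ ($p\neq0$, $r>0$, $\gcd(p,r)=1$). Suppose that both $\hat Y$ and $Y_{p/r}$ are represented by negative definite plumbings (in the sense made precise in the context). Let $F_K(x,q)$ be the series associated to $K$. Then the invariants of $Y_{p/r}$ are given by $$\widehat Z_a(Y_{p/r})=\varepsilon\, q^{d}\cdot\mathcal L^{(a)}_{p/r}\Bigl[\bigl(x^{\frac1{2r}}-x^{-\frac1{2r}}\bigr)F_K(x,q)\Bigr]$$ for some $\varepsilon\in\{\pm1\}$ and $d\in\mathbb Q$; namely $\varepsilon=\operatorname{sign}(p)\,(-1)^{\tau+1}$ and $d=\xi+\alpha(p,r)$, with $\tau,\xi,\alpha(p,r)$ as defined in the context.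
   Context: Plumbings. A plumbing tree $\Gamma$ is a finite tree with vertex set $\mathrm{Vert}$, $|\mathrm{Vert}|=s$, and integer weights $m_v$. Its linking matrix $M$ has $M_{vv}=m_v$, $M_{uv}=1$ if $u\neq v$ are adjacent, $0$ otherwise. $\pi(M)$ is the number of positive eigenvalues, $\sigma(M)$ the signature, $\vec\delta=(\deg v)_v$. $Y(\Gamma)$ is the closed 3-manifold bounding the corresponding plumbing. $\Gamma$ is negative definite if $M$ is; it is weakly negative definite if $M$ is invertible and $M^{-1}$ is negative definite on the span of the vertices of degree $\ge3$. $\mathrm{Spin}^c(Y(\Gamma))\cong(2\mathbb Z^s+\vec\delta)/(2M\mathbb Z^s)$. Contour integrals. $\oint\frac{dz}{2\pi iz}$ is the principal value (average over $|z|=1\pm\epsilon$): replace powers of $(z-1/z)$ by the average of their Laurent expansions at $0$ and $\infty$ and take the constant coefficient in $z$. Closed invariant. For $\Gamma$ weakly negative definite and $a=[\vec a]$, $$\widehat Z_a(Y;q)=(-1)^{\pi(M)}q^{\frac{3\sigma(M)-\sum_v m_v}{4}}\oint\prod_{v}\frac{dz_v}{2\pi i z_v}\Bigl(z_v-\frac1{z_v}\Bigr)^{2-\deg v}\sum_{\vec\ell\in 2M\mathbb Z^s+\vec a}q^{-\frac{(\vec\ell,M^{-1}\vec\ell)}4}\prod_v z_v^{\ell_v}.$$ The series $F_K$. The knot complement is $Y=Y(\Gamma^-,v_0)$: $\Gamma^-$ is a plumbing tree with $s$ vertices, linking matrix $M^-$, and a distinguished vertex $v_0$ of degree $1$; $\hat\Gamma=\Gamma^-\setminus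 v_0$ is negative definite with $Y(\hat\Gamma)=\hat Y$; $K\subset\hat Y$ is the unknot component of $v_0$; and the graph framing $m_{v_0}$ of $K$ is the Seifert framing (equivalently $\det M^-=0$). Relative $\mathrm{Spin}^c$ structures are $\mathrm{Spin}^c(Y,\partial Y)\cong(2\mathbb Z^s+\vec\delta)/(2M^-\mathbb Z^{s-1})$, where $\mathbb Z^{s-1}\subset \mathbb Z^s$ are the vectors with $v_0$-entry $0$. The self-conjugate one, denoted $0$, is represented by some $\vec a^-=M^-\vec b$ with $\vec b\in\mathbb Z^{s-1}$. Then $$F_K(x,q)=(-1)^{\pi(M^-)}q^{\frac{3\sigma(M^-)-\sum_v m_v}{4}}\oint\prod_{v\ne v_0}\frac{dz_v}{2\pi i z_v}\Bigl(z_v-\frac1{z_v}\Bigr)^{2-\deg v}\sum_{\vec n}q^{-\frac{(2\vec n+\vec b,\,M^-(2\vec n+\vec b))}4}\prod_{v}z_v^{\ell_v},$$ with $\vec\ell=M^-(2\vec n+\vec b)$, $z_{v_0}=x^{1/2}$, the sum being over $\vec n\in\mathbb Z^s$ with $n_{v_0}=n$ for a fixed integer $n$ (the result is independent of $n$). The solid torus and surgery. Write $\frac pr=k_1-\cfrac1{k_2-\cfrac1{\ddots-\cfrac1{k_t}}}$ and let $\Gamma^+$ be the linear tree with weights $k_1,\dots,k_t$, distinguished first vertex, and linking matrix $M^+$; it represents the solid torus $\mathbb S_{p/r}$. $Y_{p/r}=Y(\Gamma)$, where $\Gamma$ (linking matrix $M$) is obtained from $\Gamma^-$ and $\Gamma^+$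 by identifying their distinguished vertices and adding the weights there. $Y_{p/r}$ is assumed to be representable by a negative definite plumbing, and $\Gamma$ is weakly negative definite, so that $\widehat Z_a(Y_{p/r})$ can be computed from $\Gamma$. Relative $\mathrm{Spin}^c$ structures on $\mathbb S_{p/r}$ are labelled by $a\in\mathbb Z+\frac{r+1}2$: the class of $\vec a^+\in 2\mathbb Z^t+\vec\delta^+$ has label $a=\frac p2\bigl((M^+)^{-1}\vec a^+\bigr)_1$ (so that conjugation is $a\mapsto-a$). The $\mathrm{Spin}^c$ structures on $Y_{p/r}$ are labelled by $a\in\mathbb Z+\frac{r+1}2$ modulo $p\mathbb Z$: label $a$ is the class of $\vec a=\vec a^-*\vec a^+$, the vector with the entries of $\vec a^{\pm}$ away from the merged vertex and the sum of the two entries at the merged vertex, where $\vec a^-$ represents $0$ and $\vec a^+$ represents $a$. Constants. $\tau=\pi(M)-\pi(M^-)-\pi(M^+)$; $\xi=\frac34\bigl(\sigma(M)-\sigma(M^-)-\sigma(M^+)\bigr)-\frac14\bigl((\vec a,M^{-1}\vec a)-(\vec b,M^-\vec b)-(\vec a^+,(M^+)^{-1}\vec a^+)\bigr)$; $\alpha(p,r)=\frac{3\sigma(M^+)-\sum_i k_i}4+\frac1{4pr}-\frac14\bigl((M^+)^{-1}\bigr)_{tt}$. Laplace transform. $\mathcal L^{(a)}_{p/r}$ acts linearly by $x^uq^v\mapsto q^{-u^2r/p}q^v$ if $ru-a\in p\mathbb Z$, and $x^uq^v\mapsto0$ otherwise. *)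

theory Defs
  imports
    "HOL-Computational_Algebra.Formal_Laurent_Series"
    "Jordan_Normal_Form.Char_Poly"
    "Jordan_Normal_Form.Gauss_Jordan_Elimination"
begin

section \<open>Plumbing trees\<close>

text \<open>The vertex set is \<open>{0..<nv \<Gamma>}\<close>, and an edge is a two-element set of vertices. Vectors and
  matrices indexed by the vertices are those of \<open>Jordan_Normal_Form\<close>.\<close>

record plumbing =
  nv :: nat
  edges :: "nat set set"
  weight :: "nat \<Rightarrow> int"

definition plumbing_tree :: "plumbing \<Rightarrow> bool" where
  "plumbing_tree \<Gamma> \<longleftrightarrow>
     nv \<Gamma> > 0 \<and>
     edges \<Gamma> \<subseteq> {{u, v} | u v. u < nv \<Gamma> \<and> v < nv \<Gamma> \<and> u \<noteq> v} \<and>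
     (\<forall>u<nv \<Gamma>. \<forall>v<nv \<Gamma>. (u, v) \<in> {(x, y). {x, y} \<in> edges \<Gamma>}\<^sup>*) \<and>
     \<not> (\<exists>c. length c \<ge> 3 \<and> distinct c \<and> {last c, hd c} \<in> edges \<Gamma> \<and>
          (\<forall>i. Suc i < length c \<longrightarrow> {c ! i, c ! Suc i} \<in> edges \<Gamma>))"

definition deg :: "plumbing \<Rightarrow> nat \<Rightarrow> nat" where
  "deg \<Gamma> v = card {u. u \<noteq> v \<and> {u, v} \<in> edges \<Gamma>}"

definition lmat :: "plumbing \<Rightarrow> int mat" where
  "lmat \<Gamma> = mat (nv \<Gamma>) (nv \<Gamma>)
     (\<lambda>(u, v). if u = v then weight \<Gamma> v else if {u, v} \<in> edges \<Gamma> then 1 else 0)"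

abbreviation rmat :: "int mat \<Rightarrow> real mat" where
  "rmat \<equiv> map_mat real_of_int"

abbreviation rvec :: "int vec \<Rightarrow> real vec" where
  "rvec \<equiv> map_vec real_of_int"

text \<open>Only used for invertible matrices.\<close>

definition minv :: "int mat \<Rightarrow> real mat" where
  "minv M = the (mat_inverse (rmat M))"

text \<open>Eigenvalues are counted with multiplicity; for a symmetric matrix all of them are real.\<close>

definition pos_count :: "int mat \<Rightarrow> nat" where
  "pos_count M =
     (\<Sum>c\<in>{c. eigenvalue (rmat M) c \<and> c > 0}. Polynomial.order c (char_poly (rmat M)))"

definition neg_count :: "int mat \<Rightarrow> nat" where
  "neg_count M =
     (\<Sum>c\<in>{c. eigenvalue (rmat M) c \<and> c < 0}. Polynomial.order c (char_poly (rmat M)))"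

definition signature :: "int mat \<Rightarrow> int" where
  "signature M = int (pos_count M) - int (neg_count M)"

definition neg_def_on :: "nat set \<Rightarrow> real mat \<Rightarrow> bool" where
  "neg_def_on S A \<longleftrightarrow>
     (\<forall>x\<in>carrier_vec (dim_row A).
        x \<noteq> 0\<^sub>v (dim_row A) \<and> (\<forall>v<dim_row A. v \<notin> S \<longrightarrow> x $ v = 0) \<longrightarrow> x \<bullet> (A *\<^sub>v x) < 0)"

definition negative_definite :: "plumbing \<Rightarrow> bool" where
  "negative_definite \<Gamma> \<longleftrightarrow> neg_def_on {..<nv \<Gamma>} (rmat (lmat \<Gamma>))"

text \<open>Weak negative definiteness of \<open>\<Gamma>\<close> already implies that \<open>Y(\<Gamma>)\<close> bounds a negative definite
  plumbing: the chains of vertices of degree at most 2 can be replaced by chains with all weights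
  at most \<open>-2\<close>, and then the Schur complement on the remaining vertices is the inverse of the
  restriction of the inverse linking matrix to them.\<close>

definition weakly_negative_definite :: "plumbing \<Rightarrow> bool" where
  "weakly_negative_definite \<Gamma> \<longleftrightarrow>
     invertible_mat (rmat (lmat \<Gamma>)) \<and>
     neg_def_on {v. v < nv \<Gamma> \<and> deg \<Gamma> v \<ge> 3} (minv (lmat \<Gamma>))"

text \<open>The first homology group of \<open>Y(\<Gamma>)\<close> is the cokernel of the linking matrix on integer vectors.\<close>

definition integer_homology_sphere :: "plumbing \<Rightarrow> bool" where
  "integer_homology_sphere \<Gamma> \<longleftrightarrow>
     (\<forall>y\<in>carrier_vec (nv \<Gamma>). \<exists>x\<in>carrier_vec (nv \<Gamma>). lmat \<Gamma> *\<^sub>v x = y)"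

text \<open>Membership in \<open>2\<int>\<^sup>s + \<delta>\<close>, with \<open>\<delta>\<close> the vector of degrees.\<close>

definition spinc_vec :: "plumbing \<Rightarrow> int vec \<Rightarrow> bool" where
  "spinc_vec \<Gamma> a \<longleftrightarrow> a \<in> carrier_vec (nv \<Gamma>) \<and> (\<forall>v<nv \<Gamma>. even (a $ v - int (deg \<Gamma> v)))"

text \<open>The remaining vertices are renumbered, keeping their order: \<open>insert_index v\<close> is the increasing
  enumeration of the natural numbers different from \<open>v\<close>.\<close>

definition remove_vertex :: "plumbing \<Rightarrow> nat \<Rightarrow> plumbing" where
  "remove_vertex \<Gamma> v =
     \<lparr> nv = nv \<Gamma> - 1,
       edges = {{i, j} | i j. {insert_index v i, insert_index v j} \<in> edges \<Gamma>},
       weight = (\<lambda>i. weight \<Gamma> (insert_index v i)) \<rparr>"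

text \<open>The linear tree with the given weights; its distinguished vertex is \<open>0\<close>.\<close>

definition linear_plumbing :: "int list \<Rightarrow> plumbing" where
  "linear_plumbing ks =
     \<lparr> nv = length ks, edges = {{i, Suc i} | i. Suc i < length ks}, weight = (\<lambda>i. ks ! i) \<rparr>"

text \<open>Gluing along the vertex \<open>v\<close> of the first tree and the vertex \<open>0\<close> of the second one. The merged
  vertex and the other vertices of the first tree, which has \<open>s\<close> vertices, keep their numbers, and
  the vertex \<open>j > 0\<close> of the second tree becomes \<open>s + j - 1\<close>.\<close>

definition glue_index :: "nat \<Rightarrow> nat \<Rightarrow> nat \<Rightarrow> nat" where
  "glue_index s v j = (if j = 0 then v else s + j - 1)"

definition glue :: "plumbing \<Rightarrow> nat \<Rightarrow> plumbing \<Rightarrow> plumbing" where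
  "glue \<Gamma>1 v \<Gamma>2 =
     \<lparr> nv = nv \<Gamma>1 + nv \<Gamma>2 - 1,
       edges = edges \<Gamma>1 \<union> (\<lambda>e. glue_index (nv \<Gamma>1) v ` e) ` edges \<Gamma>2,
       weight = (\<lambda>i. if i = v then weight \<Gamma>1 v + weight \<Gamma>2 0
                     else if i < nv \<Gamma>1 then weight \<Gamma>1 i
                     else weight \<Gamma>2 (i + 1 - nv \<Gamma>1)) \<rparr>"

definition glue_vec :: "nat \<Rightarrow> int vec \<Rightarrow> int vec \<Rightarrow> int vec" where
  "glue_vec v a1 a2 =
     vec (dim_vec a1 + dim_vec a2 - 1)
       (\<lambda>i. if i = v then a1 $ v + a2 $ 0
            else if i < dim_vec a1 then a1 $ i
            else a2 $ (i + 1 - dim_vec a1))"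

section \<open>Formal series\<close>

text \<open>A series in \<open>q\<close> maps an exponent to its coefficient; a series in \<open>x\<close> and \<open>q\<close> maps the pair
  \<open>(u, v)\<close> to the coefficient of \<open>x\<^sup>u q\<^sup>v\<close>.\<close>

type_synonym qseries = "real \<Rightarrow> rat"
type_synonym xqseries = "real \<times> real \<Rightarrow> rat"

text \<open>The formal sum of the monomials with coefficient \<open>c i\<close> and exponent \<open>ex i\<close>, for \<open>i \<in> I\<close>. It is
  meaningful if only finitely many nonzero terms have a given exponent.\<close>

definition fsum :: "'i set \<Rightarrow> ('i \<Rightarrow> rat) \<Rightarrow> ('i \<Rightarrow> 'e) \<Rightarrow> 'e \<Rightarrow> rat" where
  "fsum I c ex = (\<lambda>e. \<Sum>i\<in>{i\<in>I. c i \<noteq> 0 \<and> ex i = e}. c i)"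

definition fsummable :: "'i set \<Rightarrow> ('i \<Rightarrow> rat) \<Rightarrow> ('i \<Rightarrow> 'e) \<Rightarrow> bool" where
  "fsummable I c ex \<longleftrightarrow> (\<forall>e. finite {i\<in>I. c i \<noteq> 0 \<and> ex i = e})"

definition qpow_mult :: "real \<Rightarrow> qseries \<Rightarrow> qseries" where
  "qpow_mult d f = (\<lambda>e. f (e - d))"

text \<open>Multiplication by x^w - x^(-w).\<close>

definition xdiff_mult :: "real \<Rightarrow> xqseries \<Rightarrow> xqseries" where
  "xdiff_mult w F = (\<lambda>(u, v). F (u - w, v) - F (u + w, v))"

text \<open>The coefficient of \<open>z\<^sup>k\<close> in the average of the Laurent expansions of \<open>(z - 1/z)\<^sup>m\<close> at \<open>0\<close>
  and at \<open>\<infinity>\<close>. The latter is a Laurent series in \<open>1/z\<close>.\<close>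

definition pv_coeff :: "int \<Rightarrow> int \<Rightarrow> rat" where
  "pv_coeff m k =
     (fls_nth ((fls_X - inverse fls_X) powi m) k +
      fls_nth ((inverse fls_X - fls_X) powi m) (- k)) / 2"

text \<open>The constant coefficient, in the variables at the vertices in \<open>A\<close>, of the product over those
  vertices of (z_v - 1/z_v)^(2 - deg v) z_v^(l_v).\<close>

definition contour :: "plumbing \<Rightarrow> nat set \<Rightarrow> int vec \<Rightarrow> rat" where
  "contour \<Gamma> A l = (\<Prod>v\<in>A. pv_coeff (2 - int (deg \<Gamma> v)) (- (l $ v)))"

definition prefactor_exp :: "plumbing \<Rightarrow> real" where
  "prefactor_exp \<Gamma> = (3 * real_of_int (signature (lmat \<Gamma>)) - (\<Sum>v<nv \<Gamma>. real_of_int (weight \<Gamma> v))) / 4"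

section \<open>The invariants\<close>

text \<open>The sum is finite in each degree if \<open>\<Gamma>\<close> is weakly negative definite, because \<open>contour\<close>
  allows only finitely many values of \<open>l\<^sub>v\<close> at the vertices of degree at most 2.\<close>

definition Zhat :: "plumbing \<Rightarrow> int vec \<Rightarrow> qseries" where
  "Zhat \<Gamma> a =
     fsum {2 \<cdot>\<^sub>v (lmat \<Gamma> *\<^sub>v n) + a | n. n \<in> carrier_vec (nv \<Gamma>)}
       (\<lambda>l. (- 1) ^ pos_count (lmat \<Gamma>) * contour \<Gamma> {..<nv \<Gamma>} l)
       (\<lambda>l. prefactor_exp \<Gamma> - (rvec l \<bullet> (minv (lmat \<Gamma>) *\<^sub>v rvec l)) / 4)"

text \<open>The sum is finite in each degree if the tree without \<open>v0\<close> is negative definite. Since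
  the variable at \<open>v0\<close> is the square root of \<open>x\<close>, the exponent of \<open>x\<close> is half the entry of \<open>l\<close> at \<open>v0\<close>.\<close>

definition FK :: "plumbing \<Rightarrow> nat \<Rightarrow> int vec \<Rightarrow> int \<Rightarrow> xqseries" where
  "FK \<Gamma> v0 b n0 =
     fsum {2 \<cdot>\<^sub>v n + b | n. n \<in> carrier_vec (nv \<Gamma>) \<and> n $ v0 = n0}
       (\<lambda>y. (- 1) ^ pos_count (lmat \<Gamma>) * contour \<Gamma> ({..<nv \<Gamma>} - {v0}) (lmat \<Gamma> *\<^sub>v y))
       (\<lambda>y. (real_of_int ((lmat \<Gamma> *\<^sub>v y) $ v0) / 2,
             prefactor_exp \<Gamma> - real_of_int (y \<bullet> (lmat \<Gamma> *\<^sub>v y)) / 4))"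

text \<open>The Laplace transform. A monomial \<open>x\<^sup>u q\<^sup>v\<close> outside of the index set is sent to \<open>0\<close>.\<close>

definition laplace_index :: "int \<Rightarrow> int \<Rightarrow> real \<Rightarrow> (real \<times> real) set" where
  "laplace_index p r a = {(u, v). \<exists>k::int. real_of_int r * u - a = real_of_int (p * k)}"

definition laplace_exp :: "int \<Rightarrow> int \<Rightarrow> real \<times> real \<Rightarrow> real" where
  "laplace_exp p r = (\<lambda>(u, v). v - u\<^sup>2 * real_of_int r / real_of_int p)"

definition laplace :: "int \<Rightarrow> int \<Rightarrow> real \<Rightarrow> xqseries \<Rightarrow> qseries" where
  "laplace p r a G = fsum (laplace_index p r a) G (laplace_exp p r)"

definition laplace_defined :: "int \<Rightarrow> int \<Rightarrow> real \<Rightarrow> xqseries \<Rightarrow> bool" where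
  "laplace_defined p r a G \<longleftrightarrow> fsummable (laplace_index p r a) G (laplace_exp p r)"

section \<open>Surgery\<close>

text \<open>\<open>contfrac [k1, \<dots>, kt] x\<close> means \<open>x = k1 - 1 / (k2 - 1 / (\<dots> - 1 / kt))\<close>, with nonzero
  denominators throughout.\<close>

inductive contfrac :: "int list \<Rightarrow> real \<Rightarrow> bool" where
  "contfrac [k] (real_of_int k)"
| "contfrac ks x \<Longrightarrow> x \<noteq> 0 \<Longrightarrow> contfrac (k # ks) (real_of_int k - 1 / x)"

text \<open>\<open>ap\<close> represents the relative spin-c structure with label \<open>a\<close> on the solid torus.\<close>

definition torus_label :: "int list \<Rightarrow> int \<Rightarrow> int vec \<Rightarrow> real \<Rightarrow> bool" where
  "torus_label ks p ap a \<longleftrightarrow>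
     spinc_vec (linear_plumbing ks) ap \<and>
     a = real_of_int p / 2 * (minv (lmat (linear_plumbing ks)) *\<^sub>v rvec ap) $ 0"

definition tau :: "plumbing \<Rightarrow> plumbing \<Rightarrow> plumbing \<Rightarrow> int" where
  "tau \<Gamma> \<Gamma>m \<Gamma>p =
     int (pos_count (lmat \<Gamma>)) - int (pos_count (lmat \<Gamma>m)) - int (pos_count (lmat \<Gamma>p))"

definition xi :: "plumbing \<Rightarrow> plumbing \<Rightarrow> plumbing \<Rightarrow> int vec \<Rightarrow> int vec \<Rightarrow> int vec \<Rightarrow> real" where
  "xi \<Gamma> \<Gamma>m \<Gamma>p a b ap =
     3 / 4 * real_of_int (signature (lmat \<Gamma>) - signature (lmat \<Gamma>m) - signature (lmat \<Gamma>p))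
     - 1 / 4 * (rvec a \<bullet> (minv (lmat \<Gamma>) *\<^sub>v rvec a)
                - real_of_int (b \<bullet> (lmat \<Gamma>m *\<^sub>v b))
                - rvec ap \<bullet> (minv (lmat \<Gamma>p) *\<^sub>v rvec ap))"

definition alpha :: "int list \<Rightarrow> int \<Rightarrow> int \<Rightarrow> real" where
  "alpha ks p r =
     (3 * real_of_int (signature (lmat (linear_plumbing ks))) - real_of_int (sum_list ks)) / 4
     + 1 / (4 * real_of_int p * real_of_int r)
     - 1 / 4 * minv (lmat (linear_plumbing ks)) $$ (length ks - 1, length ks - 1)"

end

theory Submission
  imports Defs
begin

text \<open>Since the tree without \<open>v0\<close> is unimodular and \<open>M\<^sup>-\<close> is singular, the kernel of \<open>M\<^sup>-\<close> contains
  an integer vector with entry \<open>1\<close> at \<open>v0\<close>. Adding multiples of it, one can glue any solutions over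
  \<open>\<Gamma>\<^sup>-\<close> and over the chain, which makes \<open>(l, M\<inverse> l)\<close>, for \<open>l = - M\<^sup>- y\<close> away from the chain, the sum
  of \<open>(y, M\<^sup>- y)\<close> and of a quadratic form in the chain. The contour integral forces \<open>l\<close> to vanish on
  the chain, up to an entry \<open>\<plusminus>1\<close> at its end; these two values give the two terms of
  \<open>x\<^sup>1\<^sup>/\<^sup>2\<^sup>r - x\<^sup>-\<^sup>1\<^sup>/\<^sup>2\<^sup>r\<close>. The form in the chain involves only the corner entries \<open>r / p\<close>, \<open>\<plusminus>1 / p\<close> and
  the last diagonal entry of \<open>(M\<^sup>+)\<inverse>\<close>, and completing the square gives the exponent of the Laplace
  transform.\<close>

section \<open>Formal sums\<close>

text \<open>No block inverse of the glued matrix is ever computed, since \<open>M\<^sup>-\<close>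
  has no inverse to start from. Linking matrices act on functions through \<open>nmap\<close>, and
  their symmetry, paired with one known solution, reads off whichever entry of another solution is
  wanted. The Laplace condition turns out to be the spin-c class. The preimage of the difference
  between \<open>l\<close> and the representative of the class takes the value
  \<open>2 * (r * u - a) / p\<close> at the merged vertex. The chain recurrence spreads evenness
  from there along the chain, and on the other side the preimage is then even too. Signs come from
  two parities. The sign of the chain determinant is tied to its positive eigenvalues, which brings
  \<open>sgn p\<close> and the count for \<open>M\<^sup>+\<close> into the formula; passing to the
  conjugate costs a minus sign by the handshake lemma. A sum over an infinite set is 0 by default,
  so finiteness must precede every rearrangement. It is proved once, for the closed invariant, and
  pulled back along the injection \<open>h\<close> to the series of the knot and to the Laplace
  transform.\<close>

lemma fsum_fsum:
  assumes fin: "\<And>e. finite {i\<in>I. c i \<noteq> 0 \<and> ex i \<in> J \<and> g (ex i) = e}"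
  shows "fsummable J (fsum I c ex) g"
    and "fsum J (fsum I c ex) g = fsum {i\<in>I. ex i \<in> J} c (g \<circ> ex)"
proof -
  let ?K = "\<lambda>e. {i\<in>I. c i \<noteq> 0 \<and> ex i \<in> J \<and> g (ex i) = e}"
  \<comment> \<open>Only an inclusion: terms with the same intermediate exponent may cancel. The
    points lost in this way are added back below as zero summands.\<close>
  have sub: "{j\<in>J. fsum I c ex j \<noteq> 0 \<and> g j = e} \<subseteq> ex ` ?K e" for e
  proof
    fix j assume j: "j \<in> {j\<in>J. fsum I c ex j \<noteq> 0 \<and> g j = e}"
    then have "{i\<in>I. c i \<noteq> 0 \<and> ex i = j} \<noteq> {}"
      unfolding fsum_def by (metis (mono_tags, lifting) mem_Collect_eq sum.empty)
    with j show "j \<in> ex ` ?K e" by auto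
  qed
  show "fsummable J (fsum I c ex) g"
    unfolding fsummable_def using finite_subset[OF sub finite_imageI[OF fin]] by blast
  show "fsum J (fsum I c ex) g = fsum {i\<in>I. ex i \<in> J} c (g \<circ> ex)"
  proof
    fix e
    have "fsum J (fsum I c ex) g e = (\<Sum>j\<in>{j\<in>J. fsum I c ex j \<noteq> 0 \<and> g j = e}. fsum I c ex j)"
      by (simp add: fsum_def[of J])
    also have "\<dots> = (\<Sum>j\<in>ex ` ?K e. fsum I c ex j)"
    proof (rule sum.mono_neutral_left)
      show "finite (ex ` ?K e)" by (rule finite_imageI[OF fin])
      show "{j\<in>J. fsum I c ex j \<noteq> 0 \<and> g j = e} \<subseteq> ex ` ?K e" by (rule sub)
    qed blast
    also have "\<dots> = (\<Sum>j\<in>ex ` ?K e. \<Sum>i\<in>{i\<in>?K e. ex i = j}. c i)"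
    proof (rule sum.cong)
      fix j assume "j \<in> ex ` ?K e"
      then have "{i\<in>I. c i \<noteq> 0 \<and> ex i = j} = {i\<in>?K e. ex i = j}" by auto
      then show "fsum I c ex j = (\<Sum>i\<in>{i\<in>?K e. ex i = j}. c i)" by (simp add: fsum_def)
    qed simp
    also have "\<dots> = (\<Sum>i\<in>?K e. c i)"
      by (rule sum.group) (rule fin finite_imageI subset_refl)+
    also have "?K e = {i\<in>{i\<in>I. ex i \<in> J}. c i \<noteq> 0 \<and> (g \<circ> ex) i = e}" by auto
    finally show "fsum J (fsum I c ex) g e = fsum {i\<in>I. ex i \<in> J} c (g \<circ> ex) e"
      by (simp add: fsum_def)
  qed
qed

text \<open>The sign \<theta> is at once the coefficient of the monomial and the direction of the
  shift in \<open>x\<close>. Finiteness allows the sum over both signs to be split.\<close>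

lemma xdiff_mult_fsum:
  assumes fin: "fsummable I c ex"
  shows "xdiff_mult w (fsum I c ex) =
    fsum (I \<times> {1, - 1}) (\<lambda>(i, \<theta>::int). of_int \<theta> * c i)
      (\<lambda>(i, \<theta>). (fst (ex i) + of_int \<theta> * w, snd (ex i)))" (is "_ = fsum _ ?c ?ex")
proof
  fix e :: "real \<times> real"
  obtain u v where e: "e = (u, v)" by force
  let ?A = "\<lambda>\<theta>::int. {i\<in>I. c i \<noteq> 0 \<and> ex i = (u - of_int \<theta> * w, v)}"
  have split: "{j\<in>I \<times> {1, - 1}. ?c j \<noteq> 0 \<and> ?ex j = e} =
      (\<lambda>i. (i, 1)) ` ?A 1 \<union> (\<lambda>i. (i, - 1)) ` ?A (- 1)"
  proof (rule Set.set_eqI)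
    fix j :: "'a \<times> int"
    obtain i \<theta> where j: "j = (i, \<theta>)" by force
    have "(fst z + t * w, snd z) = e \<longleftrightarrow> z = (u - t * w, v)" for z t
      by (cases z) (auto simp: e)
    then show "j \<in> {j\<in>I \<times> {1, - 1}. ?c j \<noteq> 0 \<and> ?ex j = e} \<longleftrightarrow>
        j \<in> (\<lambda>i. (i, 1)) ` ?A 1 \<union> (\<lambda>i. (i, - 1)) ` ?A (- 1)"
      by (auto simp: j)
  qed
  have "finite (?A \<theta>)" for \<theta>
    using fin unfolding fsummable_def by blast
  note finA = this[of 1] this[of "- 1"]
  have "fsum (I \<times> {1, - 1}) ?c ?ex e =
      sum ?c ((\<lambda>i. (i, 1)) ` ?A 1) + sum ?c ((\<lambda>i. (i, - 1)) ` ?A (- 1))"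
    unfolding fsum_def split using finA by (intro sum.union_disjoint finite_imageI) auto
  also have "\<dots> = sum c (?A 1) - sum c (?A (- 1))"
    by (simp add: sum.reindex inj_on_def sum_negf)
  finally show "xdiff_mult w (fsum I c ex) e = fsum (I \<times> {1, - 1}) ?c ?ex e"
    by (simp add: e xdiff_mult_def fsum_def)
qed

text \<open>Only the supports have to correspond: the contour integral annihilates every summand of
  the closed invariant that has no counterpart on the knot side.\<close>

lemma fsum_reindex:
  assumes bij: "bij_betw h {i\<in>I. c i \<noteq> 0} {j\<in>J. c' j \<noteq> 0}"
    and coeff: "\<And>i. i \<in> I \<Longrightarrow> c i \<noteq> 0 \<Longrightarrow> c' (h i) = k * c i"
    and exponent: "\<And>i. i \<in> I \<Longrightarrow> c i \<noteq> 0 \<Longrightarrow> ex' (h i) = d + ex i"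
  shows "fsum J c' ex' = (\<lambda>e. k * qpow_mult d (fsum I c ex) e)"
proof
  fix e
  have "bij_betw h {i\<in>I. c i \<noteq> 0 \<and> ex i = e - d} {j\<in>J. c' j \<noteq> 0 \<and> ex' j = e}"
  proof (rule bij_betw_imageI)
    show "inj_on h {i\<in>I. c i \<noteq> 0 \<and> ex i = e - d}"
      using bij_betw_imp_inj_on[OF bij] by (rule inj_on_subset) auto
    show "h ` {i\<in>I. c i \<noteq> 0 \<and> ex i = e - d} = {j\<in>J. c' j \<noteq> 0 \<and> ex' j = e}" (is "?L = ?R")
    proof
      show "?L \<subseteq> ?R"
        using bij_betw_imp_surj_on[OF bij] exponent by auto
      show "?R \<subseteq> ?L"
      proof
        fix j assume j: "j \<in> ?R"
        then have "j \<in> h ` {i\<in>I. c i \<noteq> 0}"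
          using bij_betw_imp_surj_on[OF bij] by simp
        then obtain i where "i \<in> I" "c i \<noteq> 0" "j = h i" by blast
        with j exponent[of i] show "j \<in> ?L" by auto
      qed
    qed
  qed
  then have "fsum J c' ex' e = (\<Sum>i\<in>{i\<in>I. c i \<noteq> 0 \<and> ex i = e - d}. c' (h i))"
    unfolding fsum_def by (rule sum.reindex_bij_betw[symmetric])
  also have "\<dots> = k * fsum I c ex (e - d)"
    unfolding fsum_def sum_distrib_left by (rule sum.cong) (auto simp: coeff)
  finally show "fsum J c' ex' e = k * qpow_mult d (fsum I c ex) e"
    by (simp add: qpow_mult_def)
qed

section \<open>Principal value coefficients\<close>

lemma minus_powi: "(- x) powi m = (- 1) powi m * x powi m" for x :: "'a::field"
  by (metis mult_minus1 power_int_mult_distrib)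

text \<open>Exchanging z and 1/z turns one expansion into the other up to the sign of the odd
  function z - 1/z. A single Laurent series remains, and the parity in \<open>k\<close> becomes
  visible.\<close>

lemma pv_coeff_alt:
  "pv_coeff m k = (fls_nth ((fls_X - inverse fls_X) powi m) k +
    (- 1) powi m * fls_nth ((fls_X - inverse fls_X) powi m) (- k)) / 2"
proof -
  let ?f = "fls_X - inverse fls_X :: rat fls"
  have "inverse fls_X - fls_X = - ?f" by simp
  then have "(inverse fls_X - fls_X) powi m = (- 1) powi m * ?f powi m"
    using minus_powi[of ?f m] by (simp only:)
  moreover have "fls_nth ((- 1) powi m * f) j = (- 1) powi m * fls_nth f j" for f :: "rat fls" and j
    by (cases "even m") (simp_all only: power_int_minus_left if_True if_False power_int_1_left mult_1
        mult_minus_left fls_uminus_nth)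
  ultimately show ?thesis by (simp add: pv_coeff_def)
qed

lemma pv_coeff_minus: "pv_coeff m (- k) = (- 1) powi m * pv_coeff m k"
  unfolding pv_coeff_alt by (cases "even m") (simp_all add: power_int_minus_left)

text \<open>Exponent 0 belongs to the vertices of degree 2, exponent 1 below to the leaves.\<close>

lemma pv_coeff_0: "pv_coeff 0 k = (if k = 0 then 1 else 0)"
  unfolding pv_coeff_def power_int_0_right fls_one_nth by (cases "k = 0") simp_all

lemma pv_coeff_1: "pv_coeff 1 k = (if k = 1 then 1 else if k = - 1 then - 1 else 0)"
  unfolding pv_coeff_def power_int_1_right fls_inverse_X fls_minus_nth fls_X_nth fls_X_inv_nth
  by (cases "k = 1"; cases "k = - 1") (simp_all only: if_True if_False, simp_all)

text \<open>For \<open>m \<ge> 0\<close> both expansions are the same Laurent polynomial. This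
  bounds the entries at vertices of degree at most 2, where weak negative definiteness gives no
  control.\<close>

lemma pv_coeff_eq_0:
  assumes "m \<ge> 0" "\<bar>k\<bar> > m"
  shows "pv_coeff m k = 0"
proof -
  let ?f = "fls_X - inverse fls_X :: rat fls"
  have vanish: "fls_nth (?f ^ n) j = 0" if "\<bar>j\<bar> > int n" for n j
    using that
  proof (induction n arbitrary: j)
    case (Suc n)
    have "?f ^ Suc n = fls_shift (- 1) (?f ^ n) - fls_shift 1 (?f ^ n)"
      by (simp add: algebra_simps fls_inverse_X fls_X_times_conv_shift fls_X_inv_times_conv_shift)
    with Suc show ?case by simp
  qed auto
  have "fls_nth (?f powi m) k = 0"
    using vanish[of "nat m" k] assms by (simp add: power_int_def)
  moreover have "fls_nth (?f powi m) (- k) = 0"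
    using vanish[of "nat m" "- k"] assms by (simp add: power_int_def)
  ultimately show ?thesis by (simp add: pv_coeff_alt)
qed

section \<open>Signs of the positive eigenvalues\<close>

text \<open>A monic polynomial is eventually positive, so a negative value at 0 would force a
  positive root.\<close>

lemma poly_0_pos:
  fixes P :: "real poly"
  assumes "lead_coeff P = 1" "poly P 0 \<noteq> 0" "\<And>c. c > 0 \<Longrightarrow> poly P c \<noteq> 0"
  shows "poly P 0 > 0"
proof (rule ccontr)
  assume "\<not> poly P 0 > 0"
  then have neg: "poly P 0 < 0" using assms(2) by simp
  obtain n where n: "\<forall>x\<ge>n. poly P x \<ge> 1"
    using poly_pinfty_gt_lc[of P] assms(1) by auto
  have "poly P (max n 1) > 0"
    using n[rule_format, of "max n 1"] by linarith
  then obtain x where "x > 0" "poly P x = 0"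
    using poly_IVT_pos[of 0 "max n 1" P] neg by fastforce
  with assms(3) show False by blast
qed

text \<open>Only the positive roots matter, so the polynomial need not split over the reals, and the
  spectral theorem is not needed.\<close>

lemma sgn_poly_0:
  fixes P :: "real poly"
  assumes "lead_coeff P = 1" "poly P 0 \<noteq> 0"
  shows "sgn (poly P 0) = (- 1) ^ (\<Sum>c\<in>{c. poly P c = 0 \<and> c > 0}. Polynomial.order c P)"
  using assms
proof (induction "degree P" arbitrary: P rule: less_induct)
  case less
  show ?case
  proof (cases "\<exists>c>0. poly P c = 0")
    case False
    then have "{c. poly P c = 0 \<and> c > 0} = {}" by auto
    moreover have "poly P 0 > 0" using poly_0_pos[OF less.prems] False by blast
    ultimately show ?thesis by (simp only: sum.empty power_0 sgn_pos)
  next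
    case True
    then obtain c where c: "c > 0" "poly P c = 0" by blast
    \<comment> \<open>The split-off factor has the value \<open>- c < 0\<close> at 0, so each
      positive root, counted with multiplicity, flips the sign once.\<close>
    then obtain Q where P: "P = [:- c, 1:] * Q"
      unfolding poly_eq_0_iff_dvd by (auto simp: dvd_def)
    have "P \<noteq> 0" using less.prems by auto
    then have Q0: "Q \<noteq> 0" using P by auto
    have lQ: "lead_coeff Q = 1" using less.prems(1) by (simp only: P lead_coeff_mult) simp
    have "degree P = Suc (degree Q)" unfolding P using Q0 by (subst degree_mult_eq) auto
    moreover have "poly Q 0 \<noteq> 0" using less.prems(2) by (simp add: P)
    ultimately have IH: "sgn (poly Q 0) =
        (- 1) ^ (\<Sum>c\<in>{c. poly Q c = 0 \<and> c > 0}. Polynomial.order c Q)"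
      using less.hyps lQ by simp
    let ?R = "{c. poly P c = 0 \<and> c > 0}"
    have fin: "finite ?R"
      using poly_roots_finite[OF \<open>P \<noteq> 0\<close>] by (rule finite_subset[rotated]) auto
    have ord: "Polynomial.order x [:- c, 1:] = (if x = c then 1 else 0)" for x
      using order_power_n_n[of c 1] by (auto intro: order_0I)
    have "(\<Sum>x\<in>?R. Polynomial.order x P) =
        (\<Sum>x\<in>?R. (if x = c then 1 else 0) + Polynomial.order x Q)"
      unfolding ord[symmetric] P by (intro sum.cong refl order_mult) (use \<open>P \<noteq> 0\<close> P in auto)
    also have "\<dots> = 1 + (\<Sum>x\<in>?R. Polynomial.order x Q)"
      using fin c by (simp add: sum.distrib)
    also have "(\<Sum>x\<in>?R. Polynomial.order x Q) = (\<Sum>c\<in>{c. poly Q c = 0 \<and> c > 0}. Polynomial.order c Q)"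
      by (rule sum.mono_neutral_right[OF fin]) (use Q0 in \<open>auto simp: P order_root\<close>)
    finally show ?thesis using IH c by (simp add: P sgn_mult)
  qed
qed

text \<open>The characteristic polynomial has the value \<open>(- 1) ^ n * det M\<close> at 0. This
  converts the eigenvalue count in the definition of the invariants into a determinant that can be
  computed.\<close>

lemma det_sgn_pos_count:
  fixes M :: "int mat"
  assumes M: "M \<in> carrier_mat n n" and "det M \<noteq> 0"
  shows "sgn (det M) * (- 1) ^ n = (- 1) ^ pos_count M"
proof -
  let ?A = "rmat M"
  have A: "?A \<in> carrier_mat n n" using M by simp
  have "- char_matrix ?A 0 = - 1 \<cdot>\<^sub>m ?A"
    using M by (intro eq_matI) (auto simp: char_matrix_def)
  then have p0: "poly (char_poly ?A) 0 = of_int ((- 1) ^ n * det M)"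
    unfolding char_poly_matrix[OF A] using M by simp
  have "sgn (poly (char_poly ?A) 0) =
      (- 1) ^ (\<Sum>c\<in>{c. poly (char_poly ?A) c = 0 \<and> c > 0}. Polynomial.order c (char_poly ?A))"
    using degree_monic_char_poly[OF A] assms(2) by (intro sgn_poly_0) (auto simp: p0)
  moreover have sgn: "sgn (real_of_int k) = of_int (sgn k)" for k
    by (simp add: sgn_if)
  ultimately have "of_int (sgn ((- 1) ^ n * det M)) = ((- 1) ^ pos_count M :: real)"
    by (simp only: p0 sgn pos_count_def eigenvalue_root_char_poly[OF A])
  then have "of_int (sgn (det M) * (- 1) ^ n) = (of_int ((- 1) ^ pos_count M) :: real)"
    by (cases "even n") (simp_all add: sgn_mult)
  then show ?thesis by (simp only: of_int_eq_iff)
qed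

section \<open>Finiteness of definite forms\<close>

lemma finite_int_square_le:
  fixes a b C :: real
  assumes "a > 0"
  shows "finite {k::int. a * (of_int k + b)\<^sup>2 \<le> C}"
proof (rule finite_subset)
  \<comment> \<open>The summand 1 makes the square of \<open>?D\<close> exceed
    \<open>\<bar>C\<bar> / a\<close>, which avoids a square root.\<close>
  let ?D = "\<bar>C\<bar> / a + 1"
  show "{k::int. a * (of_int k + b)\<^sup>2 \<le> C} \<subseteq> {\<lfloor>- b - ?D\<rfloor>..\<lceil>- b + ?D\<rceil>}"
  proof
    fix k :: int assume "k \<in> {k::int. a * (of_int k + b)\<^sup>2 \<le> C}"
    then have "(of_int k + b)\<^sup>2 \<le> \<bar>C\<bar> / a"
      using assms abs_ge_self[of C] by (simp add: pos_le_divide_eq mult.commute)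
    also have "\<dots> \<le> ?D\<^sup>2"
    proof -
      have "0 \<le> \<bar>C\<bar> / a" using assms by simp
      then have "\<bar>C\<bar> / a \<le> \<bar>C\<bar> / a * (\<bar>C\<bar> / a) + 2 * (\<bar>C\<bar> / a) + 1"
        using mult_nonneg_nonneg[of "\<bar>C\<bar> / a" "\<bar>C\<bar> / a"] by linarith
      then show ?thesis by (simp only: power2_eq_square distrib_left distrib_right)
    qed
    finally have "\<bar>of_int k + b\<bar> \<le> ?D"
      using assms by (intro power2_le_imp_le[of "\<bar>of_int k + b\<bar>"]) auto
    then have "- b - ?D \<le> of_int k" "of_int k \<le> - b + ?D" by linarith+
    then show "k \<in> {\<lfloor>- b - ?D\<rfloor>..\<lceil>- b + ?D\<rceil>}"
      by (auto simp: floor_le_iff le_ceiling_iff)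
  qed
qed simp

text \<open>Indexing by a set of vertices allows one index to be eliminated at a time without
  renumbering the others.\<close>

definition qform :: "nat set \<Rightarrow> (nat \<Rightarrow> nat \<Rightarrow> real) \<Rightarrow> (nat \<Rightarrow> real) \<Rightarrow> real" where
  "qform T A x = (\<Sum>u\<in>T. \<Sum>v\<in>T. A u v * x u * x v)"

lemma qform_insert:
  assumes "finite T" "w \<notin> T"
  shows "qform (insert w T) A x =
    A w w * (x w)\<^sup>2 + x w * (\<Sum>v\<in>T. (A w v + A v w) * x v) + qform T A x"
  using assms
  by (simp add: qform_def sum.distrib sum_distrib_left distrib_left distrib_right algebra_simps
      power2_eq_square)

lemma qform_cong: "(\<And>v. v \<in> T \<Longrightarrow> x v = y v) \<Longrightarrow> qform T A x = qform T A y"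
  by (simp add: qform_def)

text \<open>The Schur complement of the entry at \<open>w\<close>, for a form that need not be given by a symmetric
  matrix.\<close>

lemma qform_insert_square:
  assumes "finite T" "w \<notin> T" "A w w \<noteq> 0"
  defines "s \<equiv> \<lambda>v. A w v + A v w"
  shows "qform (insert w T) A x + (\<Sum>v\<in>insert w T. L v * x v) =
    A w w * (x w + ((\<Sum>v\<in>T. s v * x v) + L w) / (2 * A w w))\<^sup>2 +
    (qform T (\<lambda>u v. A u v - s u * s v / (4 * A w w)) x +
     (\<Sum>v\<in>T. (L v - s v * L w / (2 * A w w)) * x v) - (L w)\<^sup>2 / (4 * A w w))"
proof -
  define B where "B = (\<Sum>v\<in>T. s v * x v)"
  have 1: "qform T (\<lambda>u v. A u v - s u * s v / (4 * A w w)) x = qform T A x - B\<^sup>2 / (4 * A w w)"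
  proof -
    have "B\<^sup>2 / (4 * A w w) = (\<Sum>u\<in>T. \<Sum>v\<in>T. s u * s v / (4 * A w w) * x u * x v)"
      unfolding B_def power2_eq_square sum_product sum_divide_distrib
      by (intro sum.cong refl) (simp add: mult_ac)
    then show ?thesis by (simp add: qform_def sum_subtractf left_diff_distrib)
  qed
  have 2: "(\<Sum>v\<in>T. (L v - s v * L w / (2 * A w w)) * x v) =
      (\<Sum>v\<in>T. L v * x v) - B * L w / (2 * A w w)"
    unfolding B_def sum_distrib_right sum_divide_distrib sum_subtractf[symmetric]
    by (intro sum.cong refl) (simp add: field_simps)
  have 3: "qform (insert w T) A x = A w w * (x w)\<^sup>2 + x w * B + qform T A x"
    unfolding B_def s_def by (rule qform_insert) fact+
  have 4: "(\<Sum>v\<in>insert w T. L v * x v) = L w * x w + (\<Sum>v\<in>T. L v * x v)"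
    using assms by simp
  show ?thesis
    unfolding 1 2 3 4 B_def[symmetric] using assms(3) by (simp add: field_simps power2_eq_square)
qed

text \<open>Completing the square at \<open>w\<close> leaves a positive form on \<open>T\<close>.
  Finitely many restrictions to \<open>T\<close> remain, and each of them admits finitely many
  values at \<open>w\<close>. The linear term and the bound are general because the step changes
  both.\<close>

lemma finite_qform_le:
  assumes "finite T"
    and "\<And>x. (\<forall>v. v \<notin> T \<longrightarrow> x v = 0) \<Longrightarrow> (\<exists>v. x v \<noteq> 0) \<Longrightarrow> qform T A x > 0"
  shows "finite {x :: nat \<Rightarrow> int. (\<forall>v. v \<notin> T \<longrightarrow> x v = 0) \<and>
    qform T A (\<lambda>v. of_int (x v)) + (\<Sum>v\<in>T. L v * of_int (x v)) \<le> C}"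
  using assms
proof (induction T arbitrary: A L C rule: finite_induct)
  case empty
  have "{x :: nat \<Rightarrow> int. \<forall>v. x v = 0} = {\<lambda>_. 0}" by auto
  then show ?case
    by (intro finite_subset[OF _ finite.insertI[OF finite.emptyI]]) auto
next
  case (insert w T)
  have "qform (insert w T) A (\<lambda>v. if v = w then 1 else 0) > 0"
    by (rule insert.prems) auto
  moreover have "qform T A (\<lambda>v. if v = w then 1 else 0) = 0"
    using insert.hyps unfolding qform_def by (intro sum.neutral ballI) auto
  moreover have "(\<Sum>v\<in>T. (A w v + A v w) * (if v = w then 1 else 0)) = 0"
    using insert.hyps by (intro sum.neutral ballI) auto
  ultimately have w: "A w w > 0"
    using insert.hyps by (simp add: qform_insert)
  define s where "s = (\<lambda>v. A w v + A v w)"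
  define A' where "A' = (\<lambda>u v. A u v - s u * s v / (4 * A w w))"
  define L' where "L' = (\<lambda>v. L v - s v * L w / (2 * A w w))"
  define \<beta> where "\<beta> = (\<lambda>x. ((\<Sum>v\<in>T. s v * x v) + L w) / (2 * A w w))"
  have square: "qform (insert w T) A x + (\<Sum>v\<in>insert w T. L v * x v) =
      A w w * (x w + \<beta> x)\<^sup>2 + (qform T A' x + (\<Sum>v\<in>T. L' v * x v) - (L w)\<^sup>2 / (4 * A w w))" for x
    using qform_insert_square[of T w A x L] insert.hyps w
    by (simp add: s_def A'_def L'_def \<beta>_def)
  have pos: "qform T A' x > 0" if x: "\<forall>v. v \<notin> T \<longrightarrow> x v = 0" "\<exists>v. x v \<noteq> 0" for x
  proof -
    \<comment> \<open>The value at \<open>w\<close> that makes the completed square vanish: there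
      the large form equals the Schur complement, which therefore inherits positivity.\<close>
    let ?y = "x(w := - (\<Sum>v\<in>T. s v * x v) / (2 * A w w))"
    have "?y v = x v" if "v \<in> T" for v using insert.hyps that by auto
    then have "qform T A' ?y = qform T A' x" "(\<Sum>v\<in>T. s v * ?y v) = (\<Sum>v\<in>T. s v * x v)"
      by (auto intro: qform_cong sum.cong)
    moreover have "qform (insert w T) A ?y > 0"
    proof (rule insert.prems)
      obtain v where "x v \<noteq> 0" using x(2) by blast
      moreover have "v \<noteq> w" using calculation x(1) insert.hyps by auto
      ultimately show "\<exists>v. ?y v \<noteq> 0" by (intro exI[of _ v]) simp
    qed (use x(1) in auto)
    ultimately show ?thesis
      using qform_insert_square[of T w A ?y "\<lambda>_. 0"] insert.hyps w
      by (simp add: s_def A'_def)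
  qed
  let ?C' = "C + (L w)\<^sup>2 / (4 * A w w)"
  let ?F = "{x :: nat \<Rightarrow> int. (\<forall>v. v \<notin> T \<longrightarrow> x v = 0) \<and>
    qform T A' (\<lambda>v. of_int (x v)) + (\<Sum>v\<in>T. L' v * of_int (x v)) \<le> ?C'}"
  let ?G = "\<lambda>x. {k::int. A w w * (of_int k + \<beta> (\<lambda>v. of_int (x v)))\<^sup>2 \<le>
    ?C' - (qform T A' (\<lambda>v. of_int (x v)) + (\<Sum>v\<in>T. L' v * of_int (x v)))}"
  have "finite (\<Union>x\<in>?F. (\<lambda>k. x(w := k)) ` ?G x)"
    using insert.IH[of A' L' ?C'] pos w by (intro finite_UN_I finite_imageI finite_int_square_le) auto
  moreover have "{x :: nat \<Rightarrow> int. (\<forall>v. v \<notin> insert w T \<longrightarrow> x v = 0) \<and>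
      qform (insert w T) A (\<lambda>v. of_int (x v)) + (\<Sum>v\<in>insert w T. L v * of_int (x v)) \<le> C} \<subseteq>
      (\<Union>x\<in>?F. (\<lambda>k. x(w := k)) ` ?G x)"
  proof
    fix x :: "nat \<Rightarrow> int"
    assume x: "x \<in> {x. (\<forall>v. v \<notin> insert w T \<longrightarrow> x v = 0) \<and>
      qform (insert w T) A (\<lambda>v. of_int (x v)) + (\<Sum>v\<in>insert w T. L v * of_int (x v)) \<le> C}"
    let ?x = "\<lambda>v. real_of_int (x v)" and ?y = "\<lambda>v. real_of_int ((x(w := 0)) v)"
    have y: "?y v = ?x v" if "v \<in> T" for v using insert.hyps that by auto
    have eq: "qform T A' ?y = qform T A' ?x" "(\<Sum>v\<in>T. L' v * ?y v) = (\<Sum>v\<in>T. L' v * ?x v)"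
      "\<beta> ?y = \<beta> ?x"
      unfolding \<beta>_def using y by (auto intro!: qform_cong sum.cong arg_cong2[where f = "(/)"])
    have le: "A w w * (?x w + \<beta> ?x)\<^sup>2 + (qform T A' ?x + (\<Sum>v\<in>T. L' v * ?x v)) \<le> ?C'"
      using x square[of ?x] by simp
    moreover have "A w w * (?x w + \<beta> ?x)\<^sup>2 \<ge> 0" using w by simp
    ultimately have "x(w := 0) \<in> ?F"
      using x eq by auto
    moreover have "x w \<in> ?G (x(w := 0))"
      unfolding mem_Collect_eq eq using le by linarith
    moreover have "x = (x(w := 0))(w := x w)" by simp
    ultimately show "x \<in> (\<Union>x\<in>?F. (\<lambda>k. x(w := k)) ` ?G x)" by blast
  qed
  ultimately show ?case by (rule finite_subset[rotated])
qed

text \<open>Each bounded coordinate takes finitely many values. Fixing one of them turns its cross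
  terms into a linear term in the others, which the previous lemma tolerates.\<close>

lemma finite_qform_le_bounded:
  fixes K :: int
  assumes "finite S" "finite T" "S \<inter> T = {}"
    and "\<And>x. (\<forall>v. v \<notin> T \<longrightarrow> x v = 0) \<Longrightarrow> (\<exists>v. x v \<noteq> 0) \<Longrightarrow> qform T A x > 0"
  shows "finite {x :: nat \<Rightarrow> int. (\<forall>v. v \<notin> S \<union> T \<longrightarrow> x v = 0) \<and> (\<forall>v\<in>S. \<bar>x v\<bar> \<le> K) \<and>
    qform (S \<union> T) A (\<lambda>v. of_int (x v)) + (\<Sum>v\<in>S \<union> T. L v * of_int (x v)) \<le> C}"
  using assms(1,3)
proof (induction S arbitrary: L C rule: finite_induct)
  case empty
  then show ?case using finite_qform_le[OF assms(2,4)] by simp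
next
  case (insert w S)
  let ?U = "S \<union> T"
  have U: "finite ?U" "w \<notin> ?U" using insert assms(2) by auto
  let ?L = "\<lambda>k v. L v + of_int k * (A w v + A v w)"
  let ?F = "\<lambda>k::int. {x :: nat \<Rightarrow> int. (\<forall>v. v \<notin> ?U \<longrightarrow> x v = 0) \<and> (\<forall>v\<in>S. \<bar>x v\<bar> \<le> K) \<and>
    qform ?U A (\<lambda>v. of_int (x v)) + (\<Sum>v\<in>?U. ?L k v * of_int (x v)) \<le>
      C - A w w * (of_int k)\<^sup>2 - L w * of_int k}"
  have "finite (\<Union>k\<in>{- K..K}. (\<lambda>x. x(w := k)) ` ?F k)"
    using insert.IH insert.prems by (intro finite_UN_I finite_imageI) auto
  moreover have "{x :: nat \<Rightarrow> int. (\<forall>v. v \<notin> insert w S \<union> T \<longrightarrow> x v = 0) \<and>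
      (\<forall>v\<in>insert w S. \<bar>x v\<bar> \<le> K) \<and> qform (insert w S \<union> T) A (\<lambda>v. of_int (x v)) +
      (\<Sum>v\<in>insert w S \<union> T. L v * of_int (x v)) \<le> C} \<subseteq>
      (\<Union>k\<in>{- K..K}. (\<lambda>x. x(w := k)) ` ?F k)"
  proof
    fix x :: "nat \<Rightarrow> int"
    assume x: "x \<in> {x. (\<forall>v. v \<notin> insert w S \<union> T \<longrightarrow> x v = 0) \<and>
      (\<forall>v\<in>insert w S. \<bar>x v\<bar> \<le> K) \<and> qform (insert w S \<union> T) A (\<lambda>v. of_int (x v)) +
      (\<Sum>v\<in>insert w S \<union> T. L v * of_int (x v)) \<le> C}"
    let ?x = "\<lambda>v. real_of_int (x v)" and ?y = "\<lambda>v. real_of_int ((x(w := 0)) v)"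
    have y: "?y v = ?x v" if "v \<in> ?U" for v using U that by auto
    have eq: "qform ?U A ?y = qform ?U A ?x"
      "(\<Sum>v\<in>?U. ?L (x w) v * ?y v) = (\<Sum>v\<in>?U. L v * ?x v) + ?x w * (\<Sum>v\<in>?U. (A w v + A v w) * ?x v)"
    proof -
      show "qform ?U A ?y = qform ?U A ?x" by (rule qform_cong) (rule y)
      have "(\<Sum>v\<in>?U. ?L (x w) v * ?y v) = (\<Sum>v\<in>?U. ?L (x w) v * ?x v)"
        by (rule sum.cong) (simp_all only: y)
      then show "(\<Sum>v\<in>?U. ?L (x w) v * ?y v) =
          (\<Sum>v\<in>?U. L v * ?x v) + ?x w * (\<Sum>v\<in>?U. (A w v + A v w) * ?x v)"
        by (simp add: sum_distrib_left sum.distrib algebra_simps)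
    qed
    have "qform (insert w ?U) A ?x + (\<Sum>v\<in>insert w ?U. L v * ?x v) \<le> C"
      using x by simp
    then have "x(w := 0) \<in> ?F (x w)"
      using x U insert.hyps unfolding mem_Collect_eq eq by (auto simp: qform_insert algebra_simps)
    moreover have "x = (x(w := 0))(w := x w)" by simp
    moreover have "x w \<in> {- K..K}" using x by auto
    ultimately show "x \<in> (\<Union>k\<in>{- K..K}. (\<lambda>x. x(w := k)) ` ?F k)" by blast
  qed
  ultimately show ?case by (rule finite_subset[rotated])
qed

section \<open>Plumbing graphs as operators\<close>

definition nbrs :: "plumbing \<Rightarrow> nat \<Rightarrow> nat set" where
  "nbrs \<Gamma> v = {u. u \<noteq> v \<and> {u, v} \<in> edges \<Gamma>}"

definition plumbing_graph :: "plumbing \<Rightarrow> bool" where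
  "plumbing_graph \<Gamma> \<longleftrightarrow> edges \<Gamma> \<subseteq> {{u, v} | u v. u < nv \<Gamma> \<and> v < nv \<Gamma> \<and> u \<noteq> v}"

text \<open>The action of the linking matrix, over a general ring because lattice vectors are
  integral while solutions of linear systems are real. Writing a row through the neighbours makes
  gluing a local computation.\<close>

definition nmap :: "plumbing \<Rightarrow> (nat \<Rightarrow> 'a::comm_ring_1) \<Rightarrow> nat \<Rightarrow> 'a" where
  "nmap \<Gamma> x v = of_int (weight \<Gamma> v) * x v + sum x (nbrs \<Gamma> v)"

lemma deg_eq: "deg \<Gamma> v = card (nbrs \<Gamma> v)"
  by (simp add: deg_def nbrs_def)

lemma edge_less:
  assumes "plumbing_graph \<Gamma>" "{u, v} \<in> edges \<Gamma>"
  shows "u < nv \<Gamma>" "v < nv \<Gamma>" "u \<noteq> v"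
proof -
  obtain x y where "{u, v} = {x, y}" "x < nv \<Gamma>" "y < nv \<Gamma>" "x \<noteq> y"
    using assms unfolding plumbing_graph_def by blast
  then show "u < nv \<Gamma>" "v < nv \<Gamma>" "u \<noteq> v" by (auto simp: doubleton_eq_iff)
qed

lemma nbrs_less: "plumbing_graph \<Gamma> \<Longrightarrow> u \<in> nbrs \<Gamma> v \<Longrightarrow> u < nv \<Gamma>"
  by (auto simp: nbrs_def dest: edge_less)

lemma finite_nbrs: "plumbing_graph \<Gamma> \<Longrightarrow> finite (nbrs \<Gamma> v)"
  by (rule finite_subset[of _ "{..<nv \<Gamma>}"]) (auto dest: nbrs_less)

lemma sum_lmat:
  assumes "plumbing_graph \<Gamma>" "v < nv \<Gamma>"
  shows "(\<Sum>u<nv \<Gamma>. of_int (lmat \<Gamma> $$ (v, u)) * x u) = nmap \<Gamma> x v"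
proof -
  have "(\<Sum>u<nv \<Gamma>. of_int (lmat \<Gamma> $$ (v, u)) * x u) =
      (\<Sum>u<nv \<Gamma>. (if u = v then of_int (weight \<Gamma> v) * x v else 0) + (if u \<in> nbrs \<Gamma> v then x u else 0))"
    using assms(2) by (intro sum.cong) (auto simp: lmat_def nbrs_def insert_commute)
  also have "\<dots> = of_int (weight \<Gamma> v) * x v + (\<Sum>u<nv \<Gamma>. if u \<in> nbrs \<Gamma> v then x u else 0)"
    using assms(2) by (simp add: sum.distrib)
  also have "(\<Sum>u<nv \<Gamma>. if u \<in> nbrs \<Gamma> v then x u else 0) = sum x ({..<nv \<Gamma>} \<inter> nbrs \<Gamma> v)"
    by (simp add: sum.inter_restrict)
  also have "{..<nv \<Gamma>} \<inter> nbrs \<Gamma> v = nbrs \<Gamma> v"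
    using nbrs_less[OF assms(1)] by auto
  finally show ?thesis by (simp add: nmap_def)
qed

lemma lmat_carrier: "lmat \<Gamma> \<in> carrier_mat (nv \<Gamma>) (nv \<Gamma>)"
  by (simp add: lmat_def)

lemma lmat_mult_vec:
  assumes "plumbing_graph \<Gamma>" "v < nv \<Gamma>" "x \<in> carrier_vec (nv \<Gamma>)"
  shows "(lmat \<Gamma> *\<^sub>v x) $ v = nmap \<Gamma> (($) x) v"
  using assms lmat_carrier[of \<Gamma>] sum_lmat[OF assms(1,2), of "($) x"]
  by (simp add: scalar_prod_def lessThan_atLeast0)

lemma rmat_mult_vec:
  assumes "plumbing_graph \<Gamma>" "v < nv \<Gamma>" "x \<in> carrier_vec (nv \<Gamma>)"
  shows "(rmat (lmat \<Gamma>) *\<^sub>v x) $ v = nmap \<Gamma> (($) x) v"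
  using assms lmat_carrier[of \<Gamma>] sum_lmat[OF assms(1,2), of "($) x"]
  by (simp add: scalar_prod_def lessThan_atLeast0)

lemma nmap_cong:
  assumes "plumbing_graph \<Gamma>" "v < nv \<Gamma>" "\<And>u. u < nv \<Gamma> \<Longrightarrow> x u = y u"
  shows "nmap \<Gamma> x v = nmap \<Gamma> y v"
  using assms by (auto simp: nmap_def intro!: arg_cong2[where f = "(+)"] sum.cong dest: nbrs_less)

lemma nmap_add: "nmap \<Gamma> (\<lambda>u. x u + y u) v = nmap \<Gamma> x v + nmap \<Gamma> y v"
  by (simp add: nmap_def sum.distrib algebra_simps)

lemma nmap_scale: "nmap \<Gamma> (\<lambda>u. c * x u) v = c * nmap \<Gamma> x v"
  by (simp add: nmap_def sum_distrib_left algebra_simps)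

lemma nmap_minus: "nmap \<Gamma> (\<lambda>u. - x u) v = - nmap \<Gamma> x v"
  using nmap_scale[of \<Gamma> "- 1" x v] by simp

lemma nmap_diff: "nmap \<Gamma> (\<lambda>u. x u - y u) v = nmap \<Gamma> x v - nmap \<Gamma> y v"
  using nmap_add[of \<Gamma> x "\<lambda>u. - y u" v] by (simp add: nmap_minus)

lemma nmap_of_int: "nmap \<Gamma> (\<lambda>u. of_int (x u)) v = of_int (nmap \<Gamma> x v)"
  by (simp add: nmap_def)

text \<open>The substitute for explicit inverses: pairing with a solution for a unit vector extracts
  one entry of any other solution.\<close>

lemma nmap_sym:
  assumes "plumbing_graph \<Gamma>"
  shows "(\<Sum>v<nv \<Gamma>. y v * nmap \<Gamma> x v) = (\<Sum>v<nv \<Gamma>. x v * nmap \<Gamma> y v)"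
proof -
  have "(\<Sum>v<nv \<Gamma>. y v * nmap \<Gamma> x v) =
      (\<Sum>v<nv \<Gamma>. \<Sum>u<nv \<Gamma>. of_int (lmat \<Gamma> $$ (v, u)) * (y v * x u))"
    by (rule sum.cong) (simp_all add: sum_lmat[OF assms, symmetric] sum_distrib_left mult_ac)
  also have "\<dots> = (\<Sum>u<nv \<Gamma>. \<Sum>v<nv \<Gamma>. of_int (lmat \<Gamma> $$ (v, u)) * (y v * x u))"
    by (rule sum.swap)
  also have "\<dots> = (\<Sum>u<nv \<Gamma>. \<Sum>v<nv \<Gamma>. of_int (lmat \<Gamma> $$ (u, v)) * (x u * y v))"
    by (intro sum.cong refl) (auto simp: lmat_def insert_commute mult_ac)
  also have "\<dots> = (\<Sum>v<nv \<Gamma>. x v * nmap \<Gamma> y v)"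
    by (rule sum.cong) (simp_all add: sum_lmat[OF assms, symmetric] sum_distrib_left mult_ac)
  finally show ?thesis .
qed

text \<open>The handshake lemma: swapping the two ends matches the ordered edges in
  \<open>?L\<close> with those in \<open>?R\<close>. It decides the sign caused by
  conjugation.\<close>

lemma even_sum_deg:
  assumes "plumbing_graph \<Gamma>"
  shows "even (\<Sum>v<nv \<Gamma>. deg \<Gamma> v)"
proof -
  let ?S = "Sigma {..<nv \<Gamma>} (nbrs \<Gamma>)"
  let ?L = "{(v, u) \<in> ?S. v < u}" and ?R = "{(v, u) \<in> ?S. u < v}"
  have fin: "finite ?S" using finite_nbrs[OF assms] by blast
  have "(\<Sum>v<nv \<Gamma>. deg \<Gamma> v) = card ?S"
    by (simp add: deg_eq finite_nbrs[OF assms])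
  also have "?S = ?L \<union> ?R"
    by (auto simp: nbrs_def)
  also have "card (?L \<union> ?R) = card ?L + card ?R"
    by (rule card_Un_disjoint) (auto intro: finite_subset[OF _ fin])
  also have "card ?R = card ?L"
  proof (rule bij_betw_same_card[of prod.swap])
    show "bij_betw prod.swap ?R ?L"
      by (rule bij_betw_byWitness[of _ prod.swap])
        (auto simp: nbrs_def insert_commute dest: edge_less[OF assms])
  qed
  finally show ?thesis by simp
qed

section \<open>Inverse matrices\<close>

lemma minv:
  assumes M: "M \<in> carrier_mat n n" and "det M \<noteq> 0"
  shows "minv M \<in> carrier_mat n n" "rmat M * minv M = 1\<^sub>m n" "minv M * rmat M = 1\<^sub>m n"
proof -
  have A: "rmat M \<in> carrier_mat n n" using M by simp
  have "det (rmat M) \<noteq> 0" using assms by simp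
  then have "rmat M \<in> Units (ring_mat TYPE(real) n ())"
    by (rule det_non_zero_imp_unit[OF A])
  then obtain B where B: "mat_inverse (rmat M) = Some B"
    using mat_inverse(1)[OF A, of "()"] by (cases "mat_inverse (rmat M)") auto
  with mat_inverse(2)[OF A B] show "minv M \<in> carrier_mat n n" "rmat M * minv M = 1\<^sub>m n"
    "minv M * rmat M = 1\<^sub>m n"
    by (auto simp: minv_def)
qed

lemma minv_eqI:
  assumes "M \<in> carrier_mat n n" "det M \<noteq> 0" "x \<in> carrier_vec n" "rmat M *\<^sub>v x = y"
  shows "minv M *\<^sub>v y = x"
proof -
  have "minv M *\<^sub>v y = (minv M * rmat M) *\<^sub>v x"
    unfolding assms(4)[symmetric] using assms minv(1)[OF assms(1,2)]
    by (intro assoc_mult_mat_vec[symmetric, of _ n n _ n]) auto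
  then show ?thesis using assms(3) minv(3)[OF assms(1,2)] by simp
qed

lemma minv_solves:
  assumes "M \<in> carrier_mat n n" "det M \<noteq> 0" "y \<in> carrier_vec n"
  shows "rmat M *\<^sub>v (minv M *\<^sub>v y) = y"
proof -
  have "rmat M *\<^sub>v (minv M *\<^sub>v y) = (rmat M * minv M) *\<^sub>v y"
    using assms minv(1)[OF assms(1,2)]
    by (intro assoc_mult_mat_vec[symmetric, of _ n n _ n]) auto
  then show ?thesis using assms(3) minv(2)[OF assms(1,2)] by simp
qed

lemma det_nonzero_if_invertible:
  assumes M: "M \<in> carrier_mat n n" and "invertible_mat (rmat M)"
  shows "det M \<noteq> 0"
proof -
  obtain B where B: "rmat M * B = 1\<^sub>m n" "B * rmat M = 1\<^sub>m (dim_row B)"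
    using assms unfolding invertible_mat_def inverts_mat_def by auto
  have "dim_col B = n" using arg_cong[OF B(1), of dim_col] by simp
  moreover have "dim_row B = n" using arg_cong[OF B(2), of dim_col] M by simp
  ultimately have "det (rmat M) * det B = 1"
    using B(1) M by (subst det_mult[of _ n, symmetric]) auto
  then show ?thesis by auto
qed

section \<open>Linear chains and continued fractions\<close>

lemma plumbing_graph_linear: "plumbing_graph (linear_plumbing ks)"
  by (fastforce simp: plumbing_graph_def linear_plumbing_def)

lemma nv_linear [simp]: "nv (linear_plumbing ks) = length ks"
  by (simp add: linear_plumbing_def)

lemma weight_linear [simp]: "weight (linear_plumbing ks) i = ks ! i"
  by (simp add: linear_plumbing_def)

lemma linear_edge:
  "{i, j} \<in> edges (linear_plumbing ks) \<longleftrightarrow> i < length ks \<and> j < length ks \<and> (Suc i = j \<or> Suc j = i)"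
  by (auto simp: linear_plumbing_def doubleton_eq_iff)

lemma nbrs_linear:
  assumes "j < length ks"
  shows "nbrs (linear_plumbing ks) j =
    (if 0 < j then {j - 1} else {}) \<union> (if Suc j < length ks then {Suc j} else {})"
  using assms by (auto simp: nbrs_def linear_edge)

lemma deg_linear:
  assumes "j < length ks"
  shows "deg (linear_plumbing ks) j = of_bool (0 < j) + of_bool (Suc j < length ks)"
  using assms by (auto simp: deg_eq nbrs_linear)

lemma nmap_linear:
  assumes "j < length ks"
  shows "nmap (linear_plumbing ks) x j = of_int (ks ! j) * x j +
    (if 0 < j then x (j - 1) else 0) + (if Suc j < length ks then x (Suc j) else 0)"
  using assms by (auto simp: nmap_def nbrs_linear)

text \<open>The row at \<open>j - 1\<close> expresses \<open>x j\<close> through earlier entries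
  with integer coefficients. The lemma is applied to the rationals and to the even integers.\<close>

lemma linear_closed:
  assumes "\<And>x y. x \<in> S \<Longrightarrow> y \<in> S \<Longrightarrow> x - y \<in> S" "\<And>k x. x \<in> S \<Longrightarrow> of_int k * x \<in> S"
    and "x 0 \<in> S" "\<And>j. j < length ks \<Longrightarrow> nmap (linear_plumbing ks) x j \<in> S"
    and "j < length ks"
  shows "x j \<in> S"
  using assms(5)
proof (induction j rule: less_induct)
  case (less j)
  show ?case
  proof (cases j)
    case 0
    then show ?thesis using assms(3) by simp
  next
    case (Suc i)
    \<comment> \<open>At the start of the chain, 0 lies in \<open>S\<close> as
      \<open>x 0 - x 0\<close>.\<close>
    have "(if 0 < i then x (i - 1) else 0) \<in> S"
      using less Suc assms(1)[OF assms(3,3)] by auto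
    moreover have "x j = nmap (linear_plumbing ks) x i - of_int (ks ! i) * x i -
        (if 0 < i then x (i - 1) else 0)"
      using less.prems Suc by (simp add: nmap_linear)
    ultimately show ?thesis
      using less Suc assms(1,2,4) by simp
  qed
qed

text \<open>Euler's continuant with the signs of a negative continued fraction: the determinant of
  the chain, and the numerator whose denominator is the continuant of the tail.\<close>

fun continuant :: "int list \<Rightarrow> int" where
  "continuant [] = 1"
| "continuant [k] = k"
| "continuant (k # l # ks) = k * continuant (l # ks) - continuant ks"

lemma contfrac_continuant:
  "contfrac ks x \<Longrightarrow> ks \<noteq> [] \<and> continuant (tl ks) \<noteq> 0 \<and>
    x * of_int (continuant (tl ks)) = of_int (continuant ks)"
proof (induction rule: contfrac.induct)
  case (2 ks x k)
  then obtain l ls where ks: "ks = l # ls" by (cases ks) auto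
  with 2 have "continuant ks \<noteq> 0" by auto
  with 2 show ?case by (auto simp: ks field_simps)
qed auto

lemma coprime_continuant: "ks \<noteq> [] \<Longrightarrow> coprime (continuant ks) (continuant (tl ks))"
proof (induction ks rule: continuant.induct)
  case (3 k l ks)
  then have "coprime (continuant (l # ks)) (continuant ks)" by simp
  then have "coprime (continuant (l # ks)) (- continuant ks + k * continuant (l # ks))"
    by (metis add.commute coprime_commute coprime_minus_left_iff gcd_add_mult coprime_iff_gcd_eq_1)
  then show ?case by (simp add: coprime_commute)
qed auto

lemma continuant_drop:
  assumes "j < length ks"
  shows "continuant (drop j ks) = ks ! j * continuant (drop (Suc j) ks) -
    (if Suc j < length ks then continuant (drop (Suc (Suc j)) ks) else 0)"
proof (cases "Suc j < length ks")
  case True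
  have "drop j ks = ks ! j # ks ! Suc j # drop (Suc (Suc j)) ks"
    using True by (simp add: Cons_nth_drop_Suc)
  moreover have "drop (Suc j) ks = ks ! Suc j # drop (Suc (Suc j)) ks"
    using True by (simp add: Cons_nth_drop_Suc)
  ultimately show ?thesis using True by simp
next
  case False
  have "drop j ks = ks ! j # drop (Suc j) ks"
    using assms by (simp add: Cons_nth_drop_Suc)
  with False show ?thesis by simp
qed

text \<open>The alternating tail continuants form the first column of the adjugate of the linking
  matrix of the chain.\<close>

lemma nmap_continuant:
  assumes "j < length ks"
  shows "nmap (linear_plumbing ks) (\<lambda>j. (- 1) ^ j * continuant (drop (Suc j) ks)) j =
    (if j = 0 then continuant ks else 0)"
proof (cases j)
  case 0
  then show ?thesis using assms continuant_drop[of 0 ks] by (simp add: nmap_linear)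
next
  case (Suc i)
  have "nmap (linear_plumbing ks) (\<lambda>j. (- 1) ^ j * continuant (drop (Suc j) ks)) j =
      (- 1) ^ i * (continuant (drop j ks) - (ks ! j * continuant (drop (Suc j) ks) -
        (if Suc j < length ks then continuant (drop (Suc (Suc j)) ks) else 0)))"
    using assms Suc by (simp add: nmap_linear algebra_simps)
  then show ?thesis using Suc continuant_drop[OF assms] by simp
qed

lemma lmat_linear:
  assumes "i < length ks" "j < length ks"
  shows "lmat (linear_plumbing ks) $$ (i, j) =
    (if i = j then ks ! i else if Suc i = j \<or> Suc j = i then 1 else 0)"
  using assms by (auto simp: lmat_def linear_edge)

lemma det_linear: "det (lmat (linear_plumbing ks)) = continuant ks"
proof (induction ks rule: continuant.induct)
  case 1
  then show ?case using lmat_carrier[of "linear_plumbing []"] by simp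
next
  case (2 k)
  then show ?case using det_single[of "lmat (linear_plumbing [k])"] lmat_carrier[of "linear_plumbing [k]"]
    by (simp add: lmat_linear)
next
  case (3 k l ks)
  let ?n = "length ks"
  let ?A = "lmat (linear_plumbing (k # l # ks))"
  have A: "?A \<in> carrier_mat (Suc (Suc ?n)) (Suc (Suc ?n))"
    using lmat_carrier[of "linear_plumbing (k # l # ks)"] by simp
  \<comment> \<open>The minor of the off-diagonal 1 in the first row. Its first column has a single
    nonzero entry, so a second expansion leaves the chain without its first two vertices.\<close>
  let ?B = "mat_delete ?A 0 (Suc 0)"
  have B: "?B \<in> carrier_mat (Suc ?n) (Suc ?n)"
    using mat_delete_carrier[OF A] by simp
  have A00: "mat_delete ?A 0 0 = lmat (linear_plumbing (l # ks))"
    using A lmat_carrier[of "linear_plumbing (l # ks)"]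
    by (intro eq_matI) (auto simp: mat_delete_def lmat_linear)
  have B00: "mat_delete ?B 0 0 = lmat (linear_plumbing ks)"
    using A B lmat_carrier[of "linear_plumbing ks"]
    by (intro eq_matI) (auto simp: mat_delete_def lmat_linear)
  have Bi0: "?B $$ (i, 0) = (if i = 0 then 1 else 0)" if "i < Suc ?n" for i
    using A that by (cases i) (auto simp: mat_delete_def lmat_linear)
  have "det ?B = (\<Sum>i<Suc ?n. ?B $$ (i, 0) * cofactor ?B i 0)"
    using laplace_expansion_column[OF B, of 0] by simp
  also have "\<dots> = (\<Sum>i<Suc ?n. if i = 0 then cofactor ?B 0 0 else 0)"
  proof (rule sum.cong)
    fix i assume "i \<in> {..<Suc ?n}"
    then have eq: "?B $$ (i, 0) = (if i = 0 then 1 else 0)" by (intro Bi0) simp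
    show "?B $$ (i, 0) * cofactor ?B i 0 = (if i = 0 then cofactor ?B 0 0 else 0)"
      unfolding eq by simp
  qed simp
  also have "\<dots> = cofactor ?B 0 0"
    by (subst sum.delta) simp_all
  also have "\<dots> = continuant ks"
    unfolding cofactor_def B00 using 3 by simp
  finally have detB: "det ?B = continuant ks" .
  have "det ?A = (\<Sum>j<Suc (Suc ?n). ?A $$ (0, j) * cofactor ?A 0 j)"
    using laplace_expansion_row[OF A, of 0] by simp
  also have "\<dots> = (\<Sum>j<Suc (Suc ?n). (if j = 0 then k * cofactor ?A 0 0 else 0) +
      (if j = 1 then cofactor ?A 0 1 else 0))"
    by (rule sum.cong) (auto simp: lmat_linear)
  also have "\<dots> = k * cofactor ?A 0 0 + cofactor ?A 0 1"
    by (simp only: sum.distrib sum.delta finite_lessThan lessThan_iff) simp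
  also have "\<dots> = continuant (k # l # ks)"
    using 3 detB by (simp add: cofactor_def A00)
  finally show ?case .
qed

section \<open>Gluing\<close>

lemma glue_index_0 [simp]: "glue_index s v 0 = v"
  by (simp add: glue_index_def)

lemma glue_index_eq_iff:
  assumes "v < s"
  shows "glue_index s v i = glue_index s v j \<longleftrightarrow> i = j"
  using assms by (auto simp: glue_index_def)

lemma glue_index_less_iff:
  assumes "v < s"
  shows "glue_index s v j < s \<longleftrightarrow> j = 0"
  using assms by (auto simp: glue_index_def)

lemma glue_vertices:
  assumes "v < s" "0 < t"
  shows "{..<s + t - 1} = ({..<s} - {v}) \<union> glue_index s v ` {..<t}"
    and "({..<s} - {v}) \<inter> glue_index s v ` {..<t} = {}"
    and "inj_on (glue_index s v) {..<t}"
proof -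
  show "{..<s + t - 1} = ({..<s} - {v}) \<union> glue_index s v ` {..<t}" (is "?L = ?R")
  proof
    show "?L \<subseteq> ?R"
    proof
      fix i assume i: "i \<in> ?L"
      show "i \<in> ?R"
      proof (cases "i < s")
        case True
        then show ?thesis using assms by (cases "i = v") (auto intro: image_eqI[of _ _ 0])
      next
        case False
        then have "i = glue_index s v (i + 1 - s)" "i + 1 - s < t"
          using i assms by (auto simp: glue_index_def)
        then show ?thesis by blast
      qed
    qed
    show "?R \<subseteq> ?L" using assms by (auto simp: glue_index_def)
  qed
  show "({..<s} - {v}) \<inter> glue_index s v ` {..<t} = {}"
    using assms by (auto simp: glue_index_def)
  show "inj_on (glue_index s v) {..<t}"
    using assms by (auto simp: inj_on_def glue_index_eq_iff)
qed

lemma glue_cases: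
  assumes "v < s" "0 < t" "i < s + t - 1"
  obtains "i < s" "i \<noteq> v" | j where "j < t" "i = glue_index s v j"
proof -
  have "i \<in> ({..<s} - {v}) \<union> glue_index s v ` {..<t}"
    using glue_vertices(1)[OF assms(1,2)] assms(3) by blast
  then show ?thesis using that by blast
qed

lemma sum_glue:
  assumes "v < s" "0 < t"
  shows "(\<Sum>i<s + t - 1. f i) = (\<Sum>i\<in>{..<s} - {v}. f i) + (\<Sum>j<t. f (glue_index s v j))"
  unfolding glue_vertices(1)[OF assms] using glue_vertices(2,3)[OF assms]
  by (subst sum.union_disjoint) (auto simp: sum.reindex)

lemma prod_glue:
  assumes "v < s" "0 < t"
  shows "(\<Prod>i<s + t - 1. f i) = (\<Prod>i\<in>{..<s} - {v}. f i) * (\<Prod>j<t. f (glue_index s v j))"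
  unfolding glue_vertices(1)[OF assms] using glue_vertices(2,3)[OF assms]
  by (subst prod.union_disjoint) (auto simp: prod.reindex)

lemma glue_vec_left:
  assumes "i < dim_vec a1" "i \<noteq> v" "0 < dim_vec a2"
  shows "glue_vec v a1 a2 $ i = a1 $ i"
  using assms by (simp add: glue_vec_def)

lemma glue_vec_right:
  assumes "v < dim_vec a1" "j < dim_vec a2"
  shows "glue_vec v a1 a2 $ glue_index (dim_vec a1) v j = a2 $ j + (if j = 0 then a1 $ v else 0)"
  using assms by (auto simp: glue_vec_def glue_index_def)

locale gluing =
  fixes \<Gamma>1 \<Gamma>2 :: plumbing and v0 :: nat
  assumes graph1: "plumbing_graph \<Gamma>1" and graph2: "plumbing_graph \<Gamma>2"
    and v0: "v0 < nv \<Gamma>1" and nv2: "0 < nv \<Gamma>2"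
begin

abbreviation "\<Gamma> \<equiv> glue \<Gamma>1 v0 \<Gamma>2"
abbreviation "g \<equiv> glue_index (nv \<Gamma>1) v0"

lemma nv_glue: "nv \<Gamma> = nv \<Gamma>1 + nv \<Gamma>2 - 1"
  by (simp add: glue_def)

lemma glue_edge:
  "{u, v} \<in> edges \<Gamma> \<longleftrightarrow> {u, v} \<in> edges \<Gamma>1 \<or> (\<exists>i j. u = g i \<and> v = g j \<and> {i, j} \<in> edges \<Gamma>2)"
proof -
  have "{u, v} \<in> (\<lambda>e. g ` e) ` edges \<Gamma>2 \<longleftrightarrow> (\<exists>i j. u = g i \<and> v = g j \<and> {i, j} \<in> edges \<Gamma>2)"
  proof
    assume "{u, v} \<in> (\<lambda>e. g ` e) ` edges \<Gamma>2"
    then obtain e where e: "e \<in> edges \<Gamma>2" "{u, v} = g ` e" by blast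
    then obtain i j where "e = {i, j}" using graph2 unfolding plumbing_graph_def by blast
    then have edge: "{i, j} \<in> edges \<Gamma>2"
      using e(1) by (simp only:)
    then have edge': "{j, i} \<in> edges \<Gamma>2"
      by (simp only: insert_commute[of j i])
    have "{u, v} = {g i, g j}"
      using e(2) unfolding \<open>e = {i, j}\<close> by (simp only: image_insert image_empty)
    then consider "u = g i" "v = g j" | "u = g j" "v = g i"
      unfolding doubleton_eq_iff by blast
    then show "\<exists>i j. u = g i \<and> v = g j \<and> {i, j} \<in> edges \<Gamma>2"
    proof cases
      case 1
      with edge show ?thesis by (intro exI conjI)
    next
      case 2
      with edge' show ?thesis by (intro exI conjI)
    qed
  next
    assume "\<exists>i j. u = g i \<and> v = g j \<and> {i, j} \<in> edges \<Gamma>2"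
    then obtain i j where "{u, v} = g ` {i, j}" "{i, j} \<in> edges \<Gamma>2" by auto
    then show "{u, v} \<in> (\<lambda>e. g ` e) ` edges \<Gamma>2" by (rule image_eqI)
  qed
  then show ?thesis by (simp add: glue_def)
qed

lemma g_eq_iff [simp]: "g i = g j \<longleftrightarrow> i = j"
  by (rule glue_index_eq_iff[OF v0])

lemma g_less_iff [simp]: "g j < nv \<Gamma>1 \<longleftrightarrow> j = 0"
  by (rule glue_index_less_iff[OF v0])

lemma g_less: "j < nv \<Gamma>2 \<Longrightarrow> g j < nv \<Gamma>"
  using v0 nv2 by (auto simp: nv_glue glue_index_def)

lemma plumbing_graph_glue: "plumbing_graph \<Gamma>"
  unfolding plumbing_graph_def
proof
  fix e assume "e \<in> edges \<Gamma>"
  then consider "e \<in> edges \<Gamma>1" | e' where "e' \<in> edges \<Gamma>2" "e = g ` e'"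
    by (auto simp: glue_def)
  then show "e \<in> {{u, v} | u v. u < nv \<Gamma> \<and> v < nv \<Gamma> \<and> u \<noteq> v}"
  proof cases
    case 1
    then obtain u v where "e = {u, v}" "u < nv \<Gamma>1" "v < nv \<Gamma>1" "u \<noteq> v"
      using graph1 unfolding plumbing_graph_def by blast
    moreover have "nv \<Gamma>1 \<le> nv \<Gamma>" using nv2 by (simp add: nv_glue)
    ultimately show ?thesis by fastforce
  next
    case 2
    then obtain i j where "e' = {i, j}" "i < nv \<Gamma>2" "j < nv \<Gamma>2" "i \<noteq> j"
      using graph2 unfolding plumbing_graph_def by blast
    with 2 g_less have "e = {g i, g j}" "g i < nv \<Gamma>" "g j < nv \<Gamma>" "g i \<noteq> g j" by auto
    then show ?thesis by blast
  qed
qed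

lemma nbrs_left:
  assumes "v < nv \<Gamma>1" "v \<noteq> v0"
  shows "nbrs \<Gamma> v = nbrs \<Gamma>1 v"
proof -
  have "v \<noteq> g j" for j
    using assms g_less_iff[of j] by auto
  then show ?thesis by (auto simp: nbrs_def glue_edge)
qed

lemma nbrs_right:
  assumes "0 < j"
  shows "nbrs \<Gamma> (g j) = g ` nbrs \<Gamma>2 j"
proof -
  have "{u, g j} \<notin> edges \<Gamma>1" for u
    using edge_less(2)[OF graph1, of u "g j"] assms by auto
  then show ?thesis by (auto simp: nbrs_def glue_edge)
qed

lemma nbrs_middle:
  "nbrs \<Gamma> v0 = nbrs \<Gamma>1 v0 \<union> g ` nbrs \<Gamma>2 0" "nbrs \<Gamma>1 v0 \<inter> g ` nbrs \<Gamma>2 0 = {}"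
proof -
  have g0: "g j = v0 \<longleftrightarrow> j = 0" "v0 = g j \<longleftrightarrow> j = 0" for j
    using g_eq_iff[of 0 j] g_eq_iff[of j 0] by auto
  show "nbrs \<Gamma> v0 = nbrs \<Gamma>1 v0 \<union> g ` nbrs \<Gamma>2 0"
  proof (rule Set.set_eqI)
    fix u
    have "{u, v0} \<in> edges \<Gamma> \<longleftrightarrow> {u, v0} \<in> edges \<Gamma>1 \<or> (\<exists>i. u = g i \<and> {i, 0} \<in> edges \<Gamma>2)"
      by (simp add: glue_edge g0)
    moreover have "(\<exists>i. u = g i \<and> {i, 0} \<in> edges \<Gamma>2) \<and> u \<noteq> v0 \<longleftrightarrow> u \<in> g ` nbrs \<Gamma>2 0"
      by (auto simp: nbrs_def g0)
    ultimately show "u \<in> nbrs \<Gamma> v0 \<longleftrightarrow> u \<in> nbrs \<Gamma>1 v0 \<union> g ` nbrs \<Gamma>2 0"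
      by (auto simp: nbrs_def[of \<Gamma>] nbrs_def[of \<Gamma>1])
  qed
  show "nbrs \<Gamma>1 v0 \<inter> g ` nbrs \<Gamma>2 0 = {}"
  proof -
    have "g i \<notin> nbrs \<Gamma>1 v0" if "i \<in> nbrs \<Gamma>2 0" for i
      using nbrs_less[OF graph1, of "g i" v0] that by (auto simp: nbrs_def)
    then show ?thesis by blast
  qed
qed

lemma inj_on_g: "inj_on g A"
  by (simp add: inj_on_def)

lemma deg_left: "v < nv \<Gamma>1 \<Longrightarrow> v \<noteq> v0 \<Longrightarrow> deg \<Gamma> v = deg \<Gamma>1 v"
  by (simp add: deg_eq nbrs_left)

lemma deg_right: "deg \<Gamma> (g j) = deg \<Gamma>2 j + (if j = 0 then deg \<Gamma>1 v0 else 0)"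
  using nbrs_middle finite_nbrs[OF graph1] finite_nbrs[OF graph2]
  by (auto simp: deg_eq nbrs_right card_image inj_on_g card_Un_disjoint)

lemma weight_left: "v < nv \<Gamma>1 \<Longrightarrow> v \<noteq> v0 \<Longrightarrow> weight \<Gamma> v = weight \<Gamma>1 v"
  by (simp add: glue_def)

lemma weight_right: "weight \<Gamma> (g j) = weight \<Gamma>2 j + (if j = 0 then weight \<Gamma>1 v0 else 0)"
  using v0 by (auto simp: glue_def glue_index_def)

lemma nmap_left: "v < nv \<Gamma>1 \<Longrightarrow> v \<noteq> v0 \<Longrightarrow> nmap \<Gamma> x v = nmap \<Gamma>1 x v"
  by (simp add: nmap_def nbrs_left weight_left)

text \<open>The trees interact at the merged vertex only, where weights and neighbourhoods of both
  add up.\<close>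

lemma nmap_right:
  "nmap \<Gamma> x (g j) = nmap \<Gamma>2 (\<lambda>i. x (g i)) j + (if j = 0 then nmap \<Gamma>1 x v0 else 0)"
proof (cases "j = 0")
  case True
  have "sum x (nbrs \<Gamma> v0) = sum x (nbrs \<Gamma>1 v0) + (\<Sum>i\<in>nbrs \<Gamma>2 0. x (g i))"
    using nbrs_middle finite_nbrs[OF graph1] finite_nbrs[OF graph2]
    by (simp add: sum.union_disjoint sum.reindex inj_on_g)
  with True show ?thesis
    using weight_right[of 0] by (simp add: nmap_def algebra_simps)
next
  case False
  then show ?thesis
    by (simp add: nmap_def nbrs_right weight_right sum.reindex inj_on_g)
qed

lemma glue_exhaust:
  assumes "i < nv \<Gamma>"
  obtains "i < nv \<Gamma>1" "i \<noteq> v0" | j where "j < nv \<Gamma>2" "i = g j"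
  using glue_cases[OF v0 nv2] assms unfolding nv_glue by metis

lemma sum_weight: "(\<Sum>v<nv \<Gamma>. weight \<Gamma> v) = (\<Sum>v<nv \<Gamma>1. weight \<Gamma>1 v) + (\<Sum>v<nv \<Gamma>2. weight \<Gamma>2 v)"
  unfolding nv_glue sum_glue[OF v0 nv2] using v0 nv2
  by (simp add: weight_left weight_right sum.distrib sum.remove[of "{..<nv \<Gamma>1}" v0])

end

section \<open>Removing a vertex\<close>

lemma insert_index_eq_iff: "insert_index v i = insert_index v j \<longleftrightarrow> i = j"
  by (auto simp: insert_index_def)

lemma insert_index_surj:
  assumes "i \<noteq> v" obtains j where "i = insert_index v j"
  using assms insert_delete_index[of i v] by metis

text \<open>A solution on the smaller tree, extended by 0 at \<open>v\<close>, has the same rows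
  away from \<open>v\<close>. The row at \<open>v\<close> remains free.\<close>

lemma remove_vertex_solvable:
  fixes y :: "nat \<Rightarrow> int"
  assumes graph: "plumbing_graph \<Gamma>" and v: "v < nv \<Gamma>"
    and ihs: "integer_homology_sphere (remove_vertex \<Gamma> v)"
  shows "\<exists>x. x v = 0 \<and> (\<forall>i<nv \<Gamma>. i \<noteq> v \<longrightarrow> nmap \<Gamma> x i = y i)"
proof -
  let ?R = "remove_vertex \<Gamma> v"
  let ?f = "insert_index v"
  have less: "?f i < nv \<Gamma> \<longleftrightarrow> i < nv ?R" for i
    using v by (auto simp: remove_vertex_def insert_index_def)
  have edge: "{i, j} \<in> edges ?R \<longleftrightarrow> {?f i, ?f j} \<in> edges \<Gamma>" for i j
    by (auto simp: remove_vertex_def doubleton_eq_iff insert_commute)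
  have graph': "plumbing_graph ?R"
    unfolding plumbing_graph_def
  proof
    fix e assume "e \<in> edges ?R"
    then obtain i j where "e = {i, j}" "{?f i, ?f j} \<in> edges \<Gamma>"
      by (auto simp: remove_vertex_def)
    with edge_less[OF graph, of "?f i" "?f j"] less
    show "e \<in> {{u, v} | u v. u < nv ?R \<and> v < nv ?R \<and> u \<noteq> v}" by blast
  qed
  obtain x where x: "x \<in> carrier_vec (nv ?R)" "lmat ?R *\<^sub>v x = vec (nv ?R) (\<lambda>i. y (?f i))"
    using ihs unfolding integer_homology_sphere_def by (metis vec_carrier)
  define X where "X = (\<lambda>i. if i = v then 0 else x $ delete_index v i)"
  have X: "X (?f i) = x $ i" for i
    by (simp add: X_def)
  have "nmap \<Gamma> X i = y i" if i: "i < nv \<Gamma>" "i \<noteq> v" for i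
  proof -
    obtain j where j: "i = ?f j" using i insert_index_surj by blast
    have "nbrs \<Gamma> i - {v} = ?f ` nbrs ?R j"
    proof
      show "nbrs \<Gamma> i - {v} \<subseteq> ?f ` nbrs ?R j"
      proof
        fix u assume u: "u \<in> nbrs \<Gamma> i - {v}"
        then obtain k where "u = ?f k" using insert_index_surj by blast
        with u show "u \<in> ?f ` nbrs ?R j" by (auto simp: nbrs_def edge j)
      qed
      show "?f ` nbrs ?R j \<subseteq> nbrs \<Gamma> i - {v}"
        by (auto simp: nbrs_def edge j insert_index_eq_iff)
    qed
    moreover have "sum X (nbrs \<Gamma> i) = sum X (nbrs \<Gamma> i - {v})"
      using finite_nbrs[OF graph] by (intro sum.mono_neutral_right) (auto simp: X_def)
    ultimately have "sum X (nbrs \<Gamma> i) = (\<Sum>k\<in>nbrs ?R j. x $ k)"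
      by (simp add: sum.reindex inj_on_def insert_index_eq_iff X)
    then have "nmap \<Gamma> X i = nmap ?R (($) x) j"
      by (simp add: nmap_def j X) (simp add: remove_vertex_def)
    also have "\<dots> = (lmat ?R *\<^sub>v x) $ j"
      using lmat_mult_vec[OF graph' _ x(1)] i less j by simp
    also have "\<dots> = y i"
      using i less by (simp add: x(2) j)
    finally show ?thesis .
  qed
  then show ?thesis by (intro exI[of _ X]) (simp add: X_def)
qed

section \<open>The surgery formula\<close>

locale surgery =
  fixes \<Gamma>m :: plumbing and v0 :: nat and b ap :: "int vec" and n0 p r :: int and ks :: "int list"
    and a :: real
  assumes graph: "plumbing_graph \<Gamma>m" and v0: "v0 < nv \<Gamma>m" and deg_v0: "deg \<Gamma>m v0 = 1"
    and solvable: "\<And>y :: nat \<Rightarrow> int. \<exists>x. x v0 = 0 \<and> (\<forall>i<nv \<Gamma>m. i \<noteq> v0 \<longrightarrow> nmap \<Gamma>m x i = y i)"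
    and det0: "det (lmat \<Gamma>m) = 0"
    and b: "b \<in> carrier_vec (nv \<Gamma>m)" "b $ v0 = 0"
    and am_spinc: "spinc_vec \<Gamma>m (lmat \<Gamma>m *\<^sub>v b)"
    and p: "p \<noteq> 0" and r: "r > 0" and coprime: "coprime p r"
    and cf: "contfrac ks (real_of_int p / real_of_int r)"
    and weak: "weakly_negative_definite (glue \<Gamma>m v0 (linear_plumbing ks))"
    and label: "torus_label ks p ap a"
begin

abbreviation "L \<equiv> linear_plumbing ks"
abbreviation "s \<equiv> nv \<Gamma>m"
abbreviation "t \<equiv> length ks"
abbreviation "am \<equiv> lmat \<Gamma>m *\<^sub>v b"

lemma t_pos: "0 < t"
  using contfrac_continuant[OF cf] by simp

sublocale gluing \<Gamma>m L v0
  using graph plumbing_graph_linear v0 t_pos by unfold_locales auto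

section \<open>The kernel of the singular linking matrix and the gluing of solutions\<close>

lemma vanish:
  fixes z :: "nat \<Rightarrow> 'b::comm_ring_1"
  assumes z: "z v0 = 0" "\<And>i. i < s \<Longrightarrow> i \<noteq> v0 \<Longrightarrow> nmap \<Gamma>m z i = 0" and i: "i < s"
  shows "z i = 0"
proof (cases "i = v0")
  case False
  \<comment> \<open>Injectivity is obtained from solvability: pairing \<open>z\<close> with the
    solution for the unit vector at \<open>i\<close> isolates \<open>z i\<close>. The row at
    \<open>v0\<close>, unknown for both, is multiplied by 0.\<close>
  obtain x :: "nat \<Rightarrow> int" where x: "x v0 = 0"
      "\<And>k. k < s \<Longrightarrow> k \<noteq> v0 \<Longrightarrow> nmap \<Gamma>m x k = (if k = i then 1 else 0)"
    using solvable[of "\<lambda>k. if k = i then 1 else 0"] by blast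
  have "0 = (\<Sum>k<s. of_int (x k) * nmap \<Gamma>m z k)"
    using x(1) z(2) by (intro sum.neutral[symmetric] ballI)
      (metis lessThan_iff mult_zero_left mult_zero_right of_int_0)
  also have "\<dots> = (\<Sum>k<s. z k * of_int (nmap \<Gamma>m x k))"
    using nmap_sym[OF graph, of "\<lambda>k. of_int (x k)" z] by (simp add: nmap_of_int)
  also have "\<dots> = (\<Sum>k<s. if k = i then z k else 0)"
  proof (rule sum.cong)
    fix k assume "k \<in> {..<s}"
    then show "z k * of_int (nmap \<Gamma>m x k) = (if k = i then z k else 0)"
      using z(1) x(2)[of k] False by (cases "k = v0") auto
  qed simp
  also have "\<dots> = z i" using i by simp
  finally show ?thesis by simp
qed (use z in simp)

text \<open>Unimodularity corrects the unit vector at \<open>v0\<close> so that all rows but the one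
  at \<open>v0\<close> vanish. That row is settled by pairing with some kernel vector
  \<open>z\<close> of the singular matrix, whose entry at \<open>v0\<close> is nonzero by
  \<open>vanish\<close>.\<close>

lemma kernel_exists: "\<exists>lam :: nat \<Rightarrow> int. lam v0 = 1 \<and> (\<forall>i<s. nmap \<Gamma>m lam i = 0)"
proof -
  let ?e = "\<lambda>i. if i = v0 then 1 else 0 :: int"
  obtain x :: "nat \<Rightarrow> int" where x: "x v0 = 0"
      "\<And>i. i < s \<Longrightarrow> i \<noteq> v0 \<Longrightarrow> nmap \<Gamma>m x i = - nmap \<Gamma>m ?e i"
    using solvable[of "\<lambda>i. - nmap \<Gamma>m ?e i"] by blast
  define lam where "lam = (\<lambda>i. ?e i + x i)"
  have lam: "nmap \<Gamma>m lam i = 0" if "i < s" "i \<noteq> v0" for i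
    unfolding lam_def nmap_add using x(2)[OF that] by simp
  obtain z where z: "z \<in> carrier_vec s" "z \<noteq> 0\<^sub>v s" "lmat \<Gamma>m *\<^sub>v z = 0\<^sub>v s"
    using det0 det_0_iff_vec_prod_zero[OF lmat_carrier] by blast
  have nz: "nmap \<Gamma>m (($) z) i = 0" if "i < s" for i
    using lmat_mult_vec[OF graph that z(1)] z(3) that by simp
  have "z $ v0 \<noteq> 0"
  proof
    assume "z $ v0 = 0"
    then have "z $ i = 0" if "i < s" for i
      using vanish[of "($) z" i] nz that by simp
    with z(1,2) show False by auto
  qed
  moreover have "(\<Sum>i<s. z $ i * nmap \<Gamma>m lam i) = 0"
    using nz by (simp add: nmap_sym[OF graph, of "($) z"])
  moreover have "(\<Sum>i<s. z $ i * nmap \<Gamma>m lam i) = z $ v0 * nmap \<Gamma>m lam v0"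
    using v0 lam by (simp add: sum.remove[of "{..<s}" v0])
  ultimately have "nmap \<Gamma>m lam v0 = 0" by simp
  with lam have "\<forall>i<s. nmap \<Gamma>m lam i = 0" by metis
  moreover have "lam v0 = 1" by (simp add: lam_def x)
  ultimately show ?thesis by blast
qed

definition lam :: "nat \<Rightarrow> int" where
  "lam = (SOME lam. lam v0 = 1 \<and> (\<forall>i<s. nmap \<Gamma>m lam i = 0))"

lemma lam: "lam v0 = 1" "i < s \<Longrightarrow> nmap \<Gamma>m lam i = 0"
  using someI_ex[OF kernel_exists] unfolding lam_def by auto

text \<open>The multiple of the kernel vector makes the value at the merged vertex agree with \<open>x 0\<close>.\<close>

definition lift :: "(nat \<Rightarrow> 'b::comm_ring_1) \<Rightarrow> (nat \<Rightarrow> 'b) \<Rightarrow> nat \<Rightarrow> 'b" where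
  "lift y x i = (if i < s then (x 0 + y v0) * of_int (lam i) - y i else x (i + 1 - s))"

lemma lift_g: "lift y x (g j) = x j"
  using v0 lam(1) by (auto simp: lift_def glue_index_def)

lemma nmap_lift_kernel:
  assumes "i < s"
  shows "nmap \<Gamma>m (lift y x) i = - nmap \<Gamma>m y i"
proof -
  have "nmap \<Gamma>m (lift y x) i = nmap \<Gamma>m (\<lambda>i. (x 0 + y v0) * of_int (lam i) - y i) i"
    by (rule nmap_cong[OF graph assms]) (simp add: lift_def)
  then show ?thesis
    using lam(2)[OF assms] by (simp add: nmap_diff nmap_scale nmap_of_int)
qed

lemma nmap_lift_left: "i < s \<Longrightarrow> i \<noteq> v0 \<Longrightarrow> nmap \<Gamma> (lift y x) i = - nmap \<Gamma>m y i"
  by (simp add: nmap_left nmap_lift_kernel)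

lemma nmap_lift_right:
  "nmap \<Gamma> (lift y x) (g j) = nmap L x j - (if j = 0 then nmap \<Gamma>m y v0 else 0)"
  using v0 by (simp add: nmap_right lift_g nmap_lift_kernel)

text \<open>The mixed terms form the pairing of \<open>lift y x\<close> with
  \<open>nmap \<Gamma>m y\<close>. Moving the operator to the other side removes the kernel part and
  leaves only the form in \<open>y\<close>.\<close>

lemma lift_pairing:
  "(\<Sum>i<nv \<Gamma>. lift y x i * nmap \<Gamma> (lift y x) i) =
    (\<Sum>i<s. y i * nmap \<Gamma>m y i) + (\<Sum>j<t. x j * nmap L x j)"
proof -
  have 1: "(\<Sum>i<s. lift y x i * nmap \<Gamma>m y i) = - (\<Sum>i<s. y i * nmap \<Gamma>m y i)"
    by (subst nmap_sym[OF graph]) (simp add: nmap_lift_kernel sum_negf)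
  have "(\<Sum>i<nv \<Gamma>. lift y x i * nmap \<Gamma> (lift y x) i) =
      (\<Sum>i\<in>{..<s} - {v0}. lift y x i * - nmap \<Gamma>m y i) +
      (\<Sum>j<t. x j * (nmap L x j - (if j = 0 then nmap \<Gamma>m y v0 else 0)))"
  proof -
    have "(\<Sum>i\<in>{..<s} - {v0}. lift y x i * nmap \<Gamma> (lift y x) i) =
        (\<Sum>i\<in>{..<s} - {v0}. lift y x i * - nmap \<Gamma>m y i)"
      by (rule sum.cong) (simp_all add: nmap_lift_left)
    moreover have "nv \<Gamma> = s + t - 1" by (simp add: nv_glue)
    ultimately show ?thesis
      using sum_glue[OF v0 t_pos, of "\<lambda>i. lift y x i * nmap \<Gamma> (lift y x) i"]
      by (simp only: nmap_lift_right lift_g)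
  qed
  also have "(\<Sum>j<t. x j * (nmap L x j - (if j = 0 then nmap \<Gamma>m y v0 else 0))) =
      (\<Sum>j<t. x j * nmap L x j) - (\<Sum>j<t. if j = 0 then x 0 * nmap \<Gamma>m y v0 else 0)"
    unfolding sum_subtractf[symmetric] by (rule sum.cong) (auto simp: algebra_simps)
  also have "(\<Sum>j<t. if j = 0 then x 0 * nmap \<Gamma>m y v0 else 0) = lift y x v0 * nmap \<Gamma>m y v0"
    using t_pos lift_g[of y x 0] by (subst sum.delta) simp_all
  also have "(\<Sum>i\<in>{..<s} - {v0}. lift y x i * - nmap \<Gamma>m y i) +
      ((\<Sum>j<t. x j * nmap L x j) - lift y x v0 * nmap \<Gamma>m y v0) =
      (\<Sum>j<t. x j * nmap L x j) - (\<Sum>i<s. lift y x i * nmap \<Gamma>m y i)"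
    using v0 by (simp add: sum_negf sum.remove[of "{..<s}" v0])
  finally show ?thesis using 1 by simp
qed

subsection \<open>The chain\<close>

text \<open>Two reduced fractions with the same value agree up to a common sign. This sign depends
  on the chosen expansion and not only on \<open>p / r\<close>.\<close>

lemma continuant_eq: "\<exists>\<sigma>\<in>{1, - 1}. continuant ks = \<sigma> * p \<and> continuant (tl ks) = \<sigma> * r"
proof -
  let ?D = "continuant ks" and ?E = "continuant (tl ks)"
  have "real_of_int p * of_int ?E = of_int r * of_int ?D"
    using contfrac_continuant[OF cf] r by (simp add: field_simps)
  then have eq: "p * ?E = r * ?D"
    by (simp only: of_int_mult[symmetric] of_int_eq_iff)
  have "p dvd ?D"
    using eq coprime by (metis coprime_dvd_mult_right_iff dvd_triv_left)
  moreover have "?D dvd p"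
    using eq coprime_continuant[of ks] t_pos
    by (metis coprime_dvd_mult_left_iff dvd_triv_right length_greater_0_conv)
  ultimately have "\<bar>?D\<bar> = \<bar>p\<bar>" by (rule zdvd_antisym_abs[rotated])
  then have "?D = 1 * p \<or> ?D = - 1 * p" by linarith
  moreover have "?E = \<sigma> * r" if "?D = \<sigma> * p" for \<sigma>
    using eq that p by (simp add: mult_ac)
  ultimately show ?thesis by blast
qed

text \<open>The inverse of the linking matrix of the chain has entry \<open>kappa / p\<close> at its two ends.\<close>

definition kappa :: int where
  "kappa = sgn p * (- 1) ^ (pos_count (lmat L) + 1)"

lemma kappa_square [simp]: "kappa * kappa = 1"
  using p by (simp add: kappa_def power_mult_distrib sgn_if algebra_simps flip: power_add)

text \<open>The corner entry of the inverse is \<open>(- 1) ^ (t - 1) / continuant ks\<close>. The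
  sign of the determinant, read from the positive eigenvalues, eliminates the ambiguous
  \<sigma>.\<close>

lemma kappa_continuant: "(- 1) ^ (t - 1) * p = kappa * continuant ks"
proof -
  let ?D = "continuant ks"
  obtain \<sigma> where \<sigma>: "\<sigma> \<in> {1, - 1}" "?D = \<sigma> * p" using continuant_eq by blast
  have "sgn ?D * (- 1) ^ t = (- 1) ^ pos_count (lmat L)"
    using det_sgn_pos_count[of "lmat L" t] lmat_carrier[of L] det_linear[of ks] \<sigma> p by auto
  then have "kappa * ?D = - (sgn p * (sgn ?D * ?D) * (- 1) ^ t)"
    by (simp add: kappa_def algebra_simps)
  also have "sgn ?D * ?D = \<bar>p\<bar>" using \<sigma> by (auto simp: sgn_if)
  also have "sgn p * \<bar>p\<bar> = p" by (simp add: sgn_if)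
  also have "(- 1 :: int) ^ t = - ((- 1) ^ (t - 1))"
    using t_pos by (cases t) auto
  finally show ?thesis by simp
qed

text \<open>Pairing with the vector of \<open>nmap_continuant\<close> isolates \<open>x 0\<close>;
  the factor \<open>kappa\<close> on the right-hand side cancels the one in the corner entry. The
  two boundary values are added because the ends coincide for \<open>t = 1\<close>.\<close>

lemma chain_first:
  fixes x :: "nat \<Rightarrow> real"
  assumes "\<And>j. j < t \<Longrightarrow> nmap L x j = (if j = t - 1 then of_int kappa * \<theta> else 0) + (if j = 0 then m else 0)"
  shows "of_int p * x 0 = \<theta> + of_int r * m"
proof -
  let ?G = "\<lambda>j. (- 1) ^ j * continuant (drop (Suc j) ks)"
  obtain \<sigma> where \<sigma>: "\<sigma> \<in> {1, - 1}" "continuant ks = \<sigma> * p" "continuant (tl ks) = \<sigma> * r"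
    using continuant_eq by blast
  have "of_int (continuant ks) * x 0 = (\<Sum>j<t. if j = 0 then x 0 * of_int (continuant ks) else 0)"
    using t_pos by (subst sum.delta) simp_all
  also have "\<dots> = (\<Sum>j<t. x j * of_int (nmap L ?G j))"
    by (rule sum.cong) (auto simp: nmap_continuant)
  also have "\<dots> = (\<Sum>j<t. of_int (?G j) * nmap L x j)"
    using nmap_sym[OF graph2, of x "\<lambda>j. of_int (?G j)"] by (simp only: nmap_of_int nv_linear)
  also have "\<dots> = (\<Sum>j<t. (if j = t - 1 then of_int (?G (t - 1)) * (of_int kappa * \<theta>) else 0) +
      (if j = 0 then of_int (?G 0) * m else 0))"
    using assms by (intro sum.cong) (auto simp: algebra_simps)
  also have "\<dots> = of_int ((- 1) ^ (t - 1)) * (of_int kappa * \<theta>) + of_int (\<sigma> * r) * m"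
    using t_pos \<sigma>(3) by (simp add: sum.distrib drop_Suc)
  finally have "of_int p * (of_int (\<sigma> * p) * x 0) =
      of_int ((- 1) ^ (t - 1) * p) * of_int kappa * \<theta> + of_int (p * \<sigma> * r) * m"
    by (simp add: \<sigma>(2) algebra_simps)
  also have "(- 1) ^ (t - 1) * p = kappa * (\<sigma> * p)"
    using kappa_continuant \<sigma>(2) by simp
  also have "of_int (kappa * (\<sigma> * p)) * of_int kappa * \<theta> = of_int (kappa * kappa) * (of_int (\<sigma> * p) * \<theta>)"
    by (simp only: of_int_mult mult_ac)
  finally have "of_int (\<sigma> * p) * (of_int p * x 0) = of_int (\<sigma> * p) * (\<theta> + of_int r * m)"
    by (simp add: algebra_simps)
  then show ?thesis using \<sigma>(1) p by auto
qed

lemma det_L: "det (lmat L) \<noteq> 0"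
  using continuant_eq p by (auto simp: det_linear)

lemma minv_L_solves:
  assumes "y \<in> carrier_vec t" "j < t"
  shows "nmap L (($) (minv (lmat L) *\<^sub>v y)) j = y $ j"
proof -
  have M: "lmat L \<in> carrier_mat t t" using lmat_carrier[of L] by simp
  have "minv (lmat L) *\<^sub>v y \<in> carrier_vec t"
    using minv(1)[OF M det_L] assms by simp
  then show ?thesis
    using rmat_mult_vec[OF graph2, of j "minv (lmat L) *\<^sub>v y"] minv_solves[OF M det_L assms(1)] assms(2)
    by simp
qed

definition Ntt :: real where
  "Ntt = minv (lmat L) $$ (t - 1, t - 1)"

lemma chain_last_exists:
  "\<exists>z. (\<forall>j<t. nmap L z j = (if j = t - 1 then 1 else 0)) \<and> z (t - 1) = Ntt"
proof -
  have M: "lmat L \<in> carrier_mat t t" using lmat_carrier[of L] by simp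
  let ?z = "minv (lmat L) *\<^sub>v unit_vec t (t - 1)"
  have "?z $ (t - 1) = Ntt"
    using minv(1)[OF M det_L] t_pos by (simp add: Ntt_def)
  moreover have "nmap L (($) ?z) j = (if j = t - 1 then 1 else 0)" if "j < t" for j
    using minv_L_solves[of "unit_vec t (t - 1)" j] that by simp
  ultimately show ?thesis by blast
qed

text \<open>Only the two end values of \<open>x\<close> enter: \<open>x 0\<close> is known from
  \<open>chain_first\<close>, and \<open>x (t - 1)\<close> follows by pairing with the last column
  \<open>z\<close> of the inverse. The symmetric corners give the mixed term twice.\<close>

lemma chain_quadratic:
  assumes x: "\<And>j. j < t \<Longrightarrow> nmap L x j = (if j = t - 1 then of_int (kappa * \<theta>) else 0) + (if j = 0 then m else 0)"
    and \<theta>: "\<theta> * \<theta> = 1"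
  shows "(\<Sum>j<t. x j * nmap L x j) = Ntt + (2 * of_int \<theta> * m + of_int r * m\<^sup>2) / of_int p"
proof -
  obtain z where z: "\<And>j. j < t \<Longrightarrow> nmap L z j = (if j = t - 1 then 1 else 0)" "z (t - 1) = Ntt"
    using chain_last_exists by blast
  have pair: "(\<Sum>j<t. y j * nmap L x j) = of_int (kappa * \<theta>) * y (t - 1) + m * y 0" for y
  proof -
    have "(\<Sum>j<t. y j * nmap L x j) = (\<Sum>j<t. (if j = t - 1 then of_int (kappa * \<theta>) * y (t - 1) else 0) +
        (if j = 0 then m * y 0 else 0))"
      using x by (intro sum.cong) (auto simp: algebra_simps)
    then show ?thesis using t_pos by (simp add: sum.distrib)
  qed
  have "x (t - 1) = (\<Sum>j<t. if j = t - 1 then x (t - 1) else 0)"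
    using t_pos by (subst sum.delta) simp_all
  also have "\<dots> = (\<Sum>j<t. x j * nmap L z j)"
    using z(1) by (intro sum.cong) auto
  also have "\<dots> = (\<Sum>j<t. z j * nmap L x j)"
    using nmap_sym[OF graph2, of x z] by simp
  finally have xt: "x (t - 1) = of_int (kappa * \<theta>) * Ntt + m * z 0"
    by (simp only: pair z(2))
  have z0: "of_int p * z 0 = of_int kappa"
    using chain_first[of z "of_int kappa" 0] z(1) by (simp flip: of_int_mult)
  have x0: "of_int p * x 0 = of_int \<theta> + of_int r * m"
    using chain_first[of x "of_int \<theta>" m] x by simp
  have "of_int (kappa * \<theta>) * of_int (kappa * \<theta>) = real_of_int ((kappa * kappa) * (\<theta> * \<theta>))"
    by (simp only: of_int_mult mult_ac)
  then have k: "of_int (kappa * \<theta>) * of_int (kappa * \<theta>) = (1 :: real)"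
    using \<theta> by (simp only: kappa_square mult_1 of_int_1)
  have "of_int (kappa * \<theta>) * of_int kappa = real_of_int (kappa * kappa * \<theta>)"
    by (simp only: of_int_mult mult_ac)
  then have k': "of_int (kappa * \<theta>) * of_int kappa = real_of_int \<theta>"
    by (simp only: kappa_square mult_1)
  have "(\<Sum>j<t. x j * nmap L x j) =
      of_int (kappa * \<theta>) * (of_int (kappa * \<theta>) * Ntt + m * z 0) + m * x 0"
    unfolding pair xt ..
  also have "\<dots> = of_int (kappa * \<theta>) * of_int (kappa * \<theta>) * Ntt + m * (of_int (kappa * \<theta>) * z 0 + x 0)"
    by (simp add: algebra_simps)
  also have "of_int (kappa * \<theta>) * z 0 + x 0 = (of_int \<theta> + (of_int \<theta> + of_int r * m)) / of_int p"
  proof -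
    have "of_int p * (of_int (kappa * \<theta>) * z 0 + x 0) = of_int (kappa * \<theta>) * (of_int p * z 0) + of_int p * x 0"
      by (simp add: algebra_simps)
    also have "\<dots> = of_int \<theta> + (of_int \<theta> + of_int r * m)"
      unfolding z0 x0 k' ..
    finally show ?thesis using p by (simp add: field_simps)
  qed
  finally show ?thesis
    unfolding k by (simp add: power2_eq_square algebra_simps)
qed

text \<open>\<open>minv\<close> is a real matrix, so rationality of the exponent requires an
  argument: the last column starts with \<open>kappa / p\<close>, and the chain recurrence stays in
  the rationals.\<close>

lemma Ntt_rational: "Ntt \<in> \<rat>"
proof -
  obtain z where z: "\<And>j. j < t \<Longrightarrow> nmap L z j = (if j = t - 1 then 1 else 0)" "z (t - 1) = Ntt"
    using chain_last_exists by blast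
  have "of_int p * z 0 = of_int kappa"
    using chain_first[of z "of_int kappa" 0] z(1) by (simp flip: of_int_mult)
  then have "z 0 = of_int kappa / of_int p" using p by (simp add: field_simps)
  then have "z 0 \<in> \<rat>" by simp
  moreover have "nmap L z j \<in> \<rat>" if "j < t" for j
    using z(1)[OF that] by simp
  ultimately have "z (t - 1) \<in> \<rat>"
    using t_pos by (intro linear_closed[OF Rats_diff Rats_mult[OF Rats_of_int], of z ks "t - 1"]) simp_all
  with z(2) show ?thesis by simp
qed

subsection \<open>Summands\<close>

text \<open>The vector \<open>h (y, \<theta>)\<close> is the summand of the closed invariant that corresponds to the
  summand \<open>y\<close> of \<open>FK\<close> and the term \<open>\<theta> x\<^sup>\<theta>\<^sup>/\<^sup>2\<^sup>r\<close> of the prefactor. The minus sign in front of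
  \<open>y\<close> is a conjugation: without it, the labels \<open>a\<close> and \<open>- a\<close> would be exchanged.\<close>

definition h_entry :: "(nat \<Rightarrow> int) \<Rightarrow> int \<Rightarrow> nat \<Rightarrow> int" where
  "h_entry y \<theta> i = (if i < s \<and> i \<noteq> v0 then - nmap \<Gamma>m y i else if i = g (t - 1) then kappa * \<theta> else 0)"

definition h :: "int vec \<times> int \<Rightarrow> int vec" where
  "h = (\<lambda>(y, \<theta>). vec (nv \<Gamma>) (h_entry (($) y) \<theta>))"

definition Y :: "int vec set" where
  "Y = {2 \<cdot>\<^sub>v n + b | n. n \<in> carrier_vec s \<and> n $ v0 = n0}"

definition avec :: "int vec" where
  "avec = glue_vec v0 am ap"

definition \<Lambda> :: "int vec set" where
  "\<Lambda> = {2 \<cdot>\<^sub>v (lmat \<Gamma> *\<^sub>v n) + avec | n. n \<in> carrier_vec (nv \<Gamma>)}"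

definition FK_exp :: "int vec \<Rightarrow> real \<times> real" where
  "FK_exp = (\<lambda>y. (real_of_int ((lmat \<Gamma>m *\<^sub>v y) $ v0) / 2,
     prefactor_exp \<Gamma>m - real_of_int (y \<bullet> (lmat \<Gamma>m *\<^sub>v y)) / 4))"

definition pair_exp :: "int vec \<times> int \<Rightarrow> real \<times> real" where
  "pair_exp = (\<lambda>(y, \<theta>). (fst (FK_exp y) + of_int \<theta> * (1 / (2 * real_of_int r)), snd (FK_exp y)))"

definition FK_coeff :: "int vec \<Rightarrow> rat" where
  "FK_coeff = (\<lambda>y. (- 1) ^ pos_count (lmat \<Gamma>m) * contour \<Gamma>m ({..<s} - {v0}) (lmat \<Gamma>m *\<^sub>v y))"

definition quad :: "int vec \<Rightarrow> real" where
  "quad l = rvec l \<bullet> (minv (lmat \<Gamma>) *\<^sub>v rvec l)"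

text \<open>The exponent \<open>d\<close> freed of the vector terms in \<open>xi\<close>, which
  cancel by \<open>quad_avec\<close>; hence it does not depend on the representative
  \<open>ap\<close>.\<close>

definition shift :: real where
  "shift = 3 / 4 * real_of_int (signature (lmat \<Gamma>) - signature (lmat \<Gamma>m) - signature (lmat L)) +
    alpha ks p r"

lemma h_entry_left: "i < s \<Longrightarrow> i \<noteq> v0 \<Longrightarrow> h_entry y \<theta> i = - nmap \<Gamma>m y i"
  by (simp add: h_entry_def)

lemma h_entry_right: "j < t \<Longrightarrow> h_entry y \<theta> (g j) = (if j = t - 1 then kappa * \<theta> else 0)"
  using v0 g_less_iff[of j] g_eq_iff[of j "t - 1"] by (auto simp: h_entry_def)

lemma h_nth: "i < nv \<Gamma> \<Longrightarrow> h (y, \<theta>) $ i = h_entry (($) y) \<theta> i"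
  by (simp add: h_def)

lemma h_carrier: "h (y, \<theta>) \<in> carrier_vec (nv \<Gamma>)"
  by (simp add: h_def)

lemma left_less: "i < s \<Longrightarrow> i < nv \<Gamma>"
  using t_pos unfolding nv_glue nv_linear by linarith

lemma right_less: "j < t \<Longrightarrow> g j < nv \<Gamma>"
  using g_less by simp

lemma am_nth: "i < s \<Longrightarrow> am $ i = nmap \<Gamma>m (($) b) i"
  by (rule lmat_mult_vec[OF graph _ b(1)])

lemma dim_am: "dim_vec am = s"
  using lmat_carrier[of \<Gamma>m] by simp

lemma ap_carrier: "ap \<in> carrier_vec t"
  using label by (simp add: torus_label_def spinc_vec_def)

lemma avec_carrier: "avec \<in> carrier_vec (nv \<Gamma>)"
  by (rule carrier_vecI)
    (simp only: avec_def glue_vec_def dim_vec dim_am nv_glue nv_linear carrier_vecD[OF ap_carrier])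

lemma avec_left: "i < s \<Longrightarrow> i \<noteq> v0 \<Longrightarrow> avec $ i = nmap \<Gamma>m (($) b) i"
  unfolding avec_def using ap_carrier t_pos
  by (subst glue_vec_left) (simp_all only: dim_am am_nth carrier_vecD simp_thms if_True if_False)

lemma avec_right:
  "j < t \<Longrightarrow> avec $ g j = ap $ j + (if j = 0 then nmap \<Gamma>m (($) b) v0 else 0)"
  unfolding avec_def dim_am[symmetric] using ap_carrier v0
  by (subst glue_vec_right) (simp_all only: dim_am am_nth carrier_vecD simp_thms if_True if_False)

section \<open>Preimages under the glued matrix and the exponents of \<open>q\<close>\<close>

lemma det_\<Gamma>: "det (lmat \<Gamma>) \<noteq> 0"
  using weak det_nonzero_if_invertible[OF lmat_carrier]
  unfolding weakly_negative_definite_def by blast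

lemma minv_\<Gamma>_nth:
  fixes l :: "int vec"
  assumes "l \<in> carrier_vec (nv \<Gamma>)" "\<And>i. i < nv \<Gamma> \<Longrightarrow> nmap \<Gamma> X i = of_int (l $ i)" "i < nv \<Gamma>"
  shows "(minv (lmat \<Gamma>) *\<^sub>v rvec l) $ i = X i"
proof -
  have "rmat (lmat \<Gamma>) *\<^sub>v vec (nv \<Gamma>) X = rvec l"
  proof (rule eq_vecI)
    fix i assume i: "i < dim_vec (rvec l)"
    then have "(rmat (lmat \<Gamma>) *\<^sub>v vec (nv \<Gamma>) X) $ i = nmap \<Gamma> (($) (vec (nv \<Gamma>) X)) i"
      using assms(1) by (intro rmat_mult_vec[OF plumbing_graph_glue]) auto
    also have "\<dots> = nmap \<Gamma> X i"
      using i assms(1) by (intro nmap_cong[OF plumbing_graph_glue]) auto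
    finally show "(rmat (lmat \<Gamma>) *\<^sub>v vec (nv \<Gamma>) X) $ i = rvec l $ i"
      using i assms(1,2) by simp
  qed (use assms(1) lmat_carrier[of \<Gamma>] in auto)
  then have "minv (lmat \<Gamma>) *\<^sub>v rvec l = vec (nv \<Gamma>) X"
    by (intro minv_eqI[OF lmat_carrier det_\<Gamma>]) auto
  with assms(3) show ?thesis by simp
qed

lemma quad_eq:
  fixes l :: "int vec"
  assumes "l \<in> carrier_vec (nv \<Gamma>)" "\<And>i. i < nv \<Gamma> \<Longrightarrow> nmap \<Gamma> X i = of_int (l $ i)"
  shows "quad l = (\<Sum>i<nv \<Gamma>. X i * nmap \<Gamma> X i)"
proof -
  have "dim_vec (minv (lmat \<Gamma>) *\<^sub>v rvec l) = nv \<Gamma>"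
    using minv(1)[OF lmat_carrier det_\<Gamma>] by simp
  then show ?thesis
    using assms minv_\<Gamma>_nth[OF assms]
    by (auto simp: quad_def scalar_prod_def lessThan_atLeast0 intro!: sum.cong)
qed

lemma chain_exists: "\<exists>x :: nat \<Rightarrow> real. \<forall>j<t. nmap L x j = f j"
proof (intro exI allI impI)
  fix j assume "j < t"
  then show "nmap L (($) (minv (lmat L) *\<^sub>v vec t f)) j = f j"
    using minv_L_solves[of "vec t f" j] by simp
qed

text \<open>The boundary value at the start of the chain compensates the contribution of
  \<open>\<Gamma>m\<close> at the merged vertex; what remains on the chain is the entry
  \<open>kappa * \<theta>\<close> at its end.\<close>

lemma nmap_lift_h:
  fixes y :: "int vec"
  assumes "\<And>j. j < t \<Longrightarrow> nmap L x j =
      (if j = t - 1 then of_int (kappa * \<theta>) else 0) + (if j = 0 then of_int (nmap \<Gamma>m (($) y) v0) else 0)"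
    and "i < nv \<Gamma>"
  shows "nmap \<Gamma> (lift (\<lambda>i. of_int (y $ i)) x) i = real_of_int (h (y, \<theta>) $ i)"
  using assms(2)
proof (cases i rule: glue_exhaust)
  case 1
  then show ?thesis
    using assms(2) by (simp add: h_nth h_entry_left nmap_lift_left nmap_of_int)
next
  case (2 j)
  then show ?thesis
    using assms by (simp add: h_nth h_entry_right nmap_lift_right nmap_of_int)
qed

lemma quad_h:
  fixes y :: "int vec"
  assumes y: "y \<in> carrier_vec s" and \<theta>: "\<theta> * \<theta> = 1"
  defines "m \<equiv> real_of_int (nmap \<Gamma>m (($) y) v0)"
  shows "quad (h (y, \<theta>)) = real_of_int (y \<bullet> (lmat \<Gamma>m *\<^sub>v y)) + Ntt +
    (2 * of_int \<theta> * m + of_int r * m\<^sup>2) / of_int p"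
proof -
  obtain x where x: "\<And>j. j < t \<Longrightarrow> nmap L x j =
      (if j = t - 1 then of_int (kappa * \<theta>) else 0) + (if j = 0 then m else 0)"
    using chain_exists[of "\<lambda>j. (if j = t - 1 then of_int (kappa * \<theta>) else 0) + (if j = 0 then m else 0)"]
    by blast
  have "quad (h (y, \<theta>)) = (\<Sum>i<s. of_int (y $ i) * nmap \<Gamma>m (\<lambda>i. of_int (y $ i)) i) +
      (\<Sum>j<t. x j * nmap L x j)"
    using quad_eq[OF h_carrier nmap_lift_h[OF x[unfolded m_def]]] by (simp only: lift_pairing)
  also have "(\<Sum>j<t. x j * nmap L x j) = Ntt + (2 * of_int \<theta> * m + of_int r * m\<^sup>2) / of_int p"
    by (rule chain_quadratic[OF x \<theta>])
  also have "(\<Sum>i<s. of_int (y $ i) * nmap \<Gamma>m (\<lambda>i. of_int (y $ i)) i) =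
      real_of_int (\<Sum>i<s. y $ i * (lmat \<Gamma>m *\<^sub>v y) $ i)"
    using lmat_mult_vec[OF graph _ y] by (simp add: nmap_of_int)
  also have "(\<Sum>i<s. y $ i * (lmat \<Gamma>m *\<^sub>v y) $ i) = y \<bullet> (lmat \<Gamma>m *\<^sub>v y)"
    using lmat_carrier[of \<Gamma>m] by (simp add: scalar_prod_def lessThan_atLeast0)
  finally show ?thesis by simp
qed

lemma Y_carrier: "y \<in> Y \<Longrightarrow> y \<in> carrier_vec s"
  using b by (auto simp: Y_def)

lemma mult_nth: "y \<in> Y \<Longrightarrow> i < s \<Longrightarrow> (lmat \<Gamma>m *\<^sub>v y) $ i = nmap \<Gamma>m (($) y) i"
  by (rule lmat_mult_vec[OF graph _ Y_carrier])

lemma prefactor_glue: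
  "prefactor_exp \<Gamma> = prefactor_exp \<Gamma>m +
    3 / 4 * real_of_int (signature (lmat \<Gamma>) - signature (lmat \<Gamma>m)) - real_of_int (sum_list ks) / 4"
proof -
  have "(\<Sum>v<nv \<Gamma>. weight \<Gamma> v) = (\<Sum>v<s. weight \<Gamma>m v) + sum_list ks"
    unfolding sum_weight by (simp add: sum_list_sum_nth lessThan_atLeast0)
  then have "(\<Sum>v<nv \<Gamma>. real_of_int (weight \<Gamma> v)) = (\<Sum>v<s. real_of_int (weight \<Gamma>m v)) + sum_list ks"
    by (metis of_int_add of_int_sum)
  then show ?thesis by (simp add: prefactor_exp_def field_simps)
qed

lemma exponent:
  assumes "y \<in> Y" "\<theta> * \<theta> = 1"
  shows "prefactor_exp \<Gamma> - quad (h (y, \<theta>)) / 4 = shift + laplace_exp p r (pair_exp (y, \<theta>))"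
proof -
  define m where "m = real_of_int (nmap \<Gamma>m (($) y) v0)"
  have \<theta>: "real_of_int \<theta> * real_of_int \<theta> = 1"
    using assms(2) by (metis of_int_1 of_int_mult)
  \<comment> \<open>Completing the square: \<open>m / 2 + \<theta> / (2 * r)\<close> is the exponent
    of \<open>x\<close> after multiplication by the prefactor, and the excess
    \<open>1 / (4 * p * r)\<close> is the corresponding term of \<open>alpha\<close>.\<close>
  have "(m / 2 + of_int \<theta> * (1 / (2 * of_int r)))\<^sup>2 * of_int r / of_int p =
      (2 * of_int \<theta> * m + of_int r * m\<^sup>2) / of_int p / 4 + of_int \<theta> * of_int \<theta> / (4 * of_int p * of_int r)"
    using p r by (simp add: field_simps power2_eq_square)
  moreover define W where "W = (2 * of_int \<theta> * m + of_int r * m\<^sup>2) / of_int p"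
  ultimately have l: "laplace_exp p r (pair_exp (y, \<theta>)) =
      prefactor_exp \<Gamma>m - real_of_int (y \<bullet> (lmat \<Gamma>m *\<^sub>v y)) / 4 - W / 4 - 1 / (4 * of_int p * of_int r)"
    using mult_nth[OF assms(1) v0] \<theta> by (simp add: laplace_exp_def pair_exp_def FK_exp_def m_def)
  have q: "quad (h (y, \<theta>)) = real_of_int (y \<bullet> (lmat \<Gamma>m *\<^sub>v y)) + Ntt + W"
    using quad_h[OF Y_carrier[OF assms(1)] assms(2)] by (simp only: m_def W_def)
  show ?thesis
    unfolding l q prefactor_glue shift_def alpha_def Ntt_def[symmetric] of_int_diff by argo
qed

subsection \<open>Coefficients\<close>

text \<open>As \<open>v0\<close> has degree 1, the merged vertex acts as one more link of the chain:
  the degree is 2 up to the last vertex, which is a leaf. This holds for \<open>t = 1\<close> as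
  well.\<close>

lemma contour_glue:
  "contour \<Gamma> {..<nv \<Gamma>} l = contour \<Gamma>m ({..<s} - {v0}) l *
    (\<Prod>j<t. pv_coeff (if j = t - 1 then 1 else 0) (- (l $ g j)))"
proof -
  have nv: "nv \<Gamma> = s + t - 1" by (simp add: nv_glue)
  have "(\<Prod>j<t. pv_coeff (2 - int (deg \<Gamma> (g j))) (- (l $ g j))) =
      (\<Prod>j<t. pv_coeff (if j = t - 1 then 1 else 0) (- (l $ g j)))"
    by (rule prod.cong) (auto simp: deg_right deg_linear deg_v0)
  moreover have "(\<Prod>i\<in>{..<s} - {v0}. pv_coeff (2 - int (deg \<Gamma> i)) (- (l $ i))) =
      (\<Prod>i\<in>{..<s} - {v0}. pv_coeff (2 - int (deg \<Gamma>m i)) (- (l $ i)))"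
    by (rule prod.cong) (auto simp: deg_left)
  ultimately show ?thesis
    unfolding contour_def nv prod_glue[OF v0 t_pos] by (simp only:)
qed

lemma contour_nonzero:
  fixes l :: "int vec"
  assumes "contour \<Gamma> {..<nv \<Gamma>} l \<noteq> 0" "j < t"
  shows "if j = t - 1 then l $ g j \<in> {1, - 1} else l $ g j = 0"
proof -
  have "pv_coeff (if j = t - 1 then 1 else 0) (- (l $ g j)) \<noteq> 0"
    using assms by (auto simp: contour_glue)
  then show ?thesis
    by (auto simp: pv_coeff_0 pv_coeff_1 split: if_splits)
qed

text \<open>The constant term selects the coefficient at the opposite exponent \<open>- e\<close>,
  hence the minus sign.\<close>

lemma contour_end:
  fixes l :: "int vec"
  assumes "\<And>j. j < t \<Longrightarrow> l $ g j = (if j = t - 1 then e else 0)" "e \<in> {1, - 1}"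
  shows "contour \<Gamma> {..<nv \<Gamma>} l = - (of_int e * contour \<Gamma>m ({..<s} - {v0}) l)"
proof -
  have "(\<Prod>j<t. pv_coeff (if j = t - 1 then 1 else 0) (- (l $ g j))) =
      (\<Prod>j<t. if j = t - 1 then - of_int e else 1)"
    using assms by (intro prod.cong) (auto simp: pv_coeff_0 pv_coeff_1)
  also have "\<dots> = - of_int e"
    using t_pos by (subst prod.delta) simp_all
  finally show ?thesis by (simp add: contour_glue)
qed

lemma odd_sum_deg: "odd (\<Sum>v\<in>{..<s} - {v0}. deg \<Gamma>m v)"
  using even_sum_deg[OF graph] v0 deg_v0 by (simp add: sum.remove[of "{..<s}" v0])

text \<open>Negating an entry multiplies its factor by the sign of its degree. The degrees sum to an
  even number, and leaving out the leaf \<open>v0\<close> makes the sum odd.\<close>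

lemma contour_uminus:
  fixes l l' :: "int vec"
  assumes "\<And>i. i < s \<Longrightarrow> i \<noteq> v0 \<Longrightarrow> l $ i = - (l' $ i)"
  shows "contour \<Gamma>m ({..<s} - {v0}) l = - contour \<Gamma>m ({..<s} - {v0}) l'"
proof -
  let ?V = "{..<s} - {v0}"
  have sign: "(- 1) powi (2 - int k) = (- 1 :: rat) ^ k" for k
    by (cases "even k") (simp_all add: power_int_minus_left)
  have "contour \<Gamma>m ?V l = (\<Prod>v\<in>?V. (- 1) ^ deg \<Gamma>m v * pv_coeff (2 - int (deg \<Gamma>m v)) (- (l' $ v)))"
    unfolding contour_def
  proof (rule prod.cong)
    fix v assume "v \<in> ?V"
    then have "- (l $ v) = - (- (l' $ v))" using assms by auto
    then show "pv_coeff (2 - int (deg \<Gamma>m v)) (- (l $ v)) =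
        (- 1) ^ deg \<Gamma>m v * pv_coeff (2 - int (deg \<Gamma>m v)) (- (l' $ v))"
      by (simp only: pv_coeff_minus[of _ "- (l' $ v)"] sign)
  qed simp
  also have "\<dots> = (- 1) ^ (\<Sum>v\<in>?V. deg \<Gamma>m v) * contour \<Gamma>m ?V l'"
    by (simp add: prod.distrib contour_def power_sum)
  finally show ?thesis using odd_sum_deg by simp
qed

text \<open>The minus signs from the end of the chain and from the conjugation cancel.\<close>

lemma contour_h:
  assumes "y \<in> Y" "\<theta> \<in> {1, - 1}"
  shows "contour \<Gamma> {..<nv \<Gamma>} (h (y, \<theta>)) =
    of_int (kappa * \<theta>) * contour \<Gamma>m ({..<s} - {v0}) (lmat \<Gamma>m *\<^sub>v y)"
proof -
  have "kappa \<in> {1, - 1}"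
    using p by (auto simp: kappa_def sgn_if minus_one_power_iff)
  then have "kappa * \<theta> \<in> {1, - 1}" using assms(2) by auto
  then have "contour \<Gamma> {..<nv \<Gamma>} (h (y, \<theta>)) =
      - (of_int (kappa * \<theta>) * contour \<Gamma>m ({..<s} - {v0}) (h (y, \<theta>)))"
    by (intro contour_end) (simp_all add: h_nth right_less h_entry_right)
  also have "contour \<Gamma>m ({..<s} - {v0}) (h (y, \<theta>)) = - contour \<Gamma>m ({..<s} - {v0}) (lmat \<Gamma>m *\<^sub>v y)"
    by (rule contour_uminus) (simp add: h_nth left_less h_entry_left mult_nth assms)
  finally show ?thesis by simp
qed

definition \<epsilon> :: rat where
  "\<epsilon> = of_int (sgn p) * (- 1) powi (tau \<Gamma> \<Gamma>m L + 1)"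

lemma \<epsilon>_sign: "\<epsilon> \<in> {1, - 1}"
  using p by (auto simp: \<epsilon>_def sgn_if power_int_minus_left)

text \<open>\<open>kappa\<close> supplies the part of the sign coming from \<open>p\<close> and from
  the chain; the counts for the two other matrices complete \<open>tau\<close>.\<close>

lemma \<epsilon>_kappa:
  "\<epsilon> * (- 1) ^ pos_count (lmat \<Gamma>m) = (- 1) ^ pos_count (lmat \<Gamma>) * of_int kappa"
proof -
  have *: "(- 1) powi (int A - int B - int C + 1) * (- 1) ^ B = (- 1) ^ A * (- 1 :: rat) ^ (C + 1)"
    for A B C
    by (cases "even A"; cases "even B"; cases "even C") (simp_all add: power_int_minus_left)
  have "\<epsilon> * (- 1) ^ pos_count (lmat \<Gamma>m) =
      of_int (sgn p) * ((- 1) powi (tau \<Gamma> \<Gamma>m L + 1) * (- 1) ^ pos_count (lmat \<Gamma>m))"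
    by (simp add: \<epsilon>_def)
  also have "\<dots> = (- 1) ^ pos_count (lmat \<Gamma>) * (of_int (sgn p) * (- 1) ^ (pos_count (lmat L) + 1))"
    unfolding tau_def * by simp
  finally show ?thesis by (simp add: kappa_def)
qed

lemma coefficient:
  assumes "y \<in> Y" "\<theta> \<in> {1, - 1}"
  shows "(- 1) ^ pos_count (lmat \<Gamma>) * contour \<Gamma> {..<nv \<Gamma>} (h (y, \<theta>)) = \<epsilon> * (of_int \<theta> * FK_coeff y)"
proof -
  have "(- 1) ^ pos_count (lmat \<Gamma>) * contour \<Gamma> {..<nv \<Gamma>} (h (y, \<theta>)) =
      ((- 1) ^ pos_count (lmat \<Gamma>) * of_int kappa) *
      (of_int \<theta> * contour \<Gamma>m ({..<s} - {v0}) (lmat \<Gamma>m *\<^sub>v y))"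
    unfolding contour_h[OF assms] by simp
  also have "\<dots> = \<epsilon> * (of_int \<theta> * FK_coeff y)"
    unfolding \<epsilon>_kappa[symmetric] by (simp add: FK_coeff_def)
  finally show ?thesis .
qed

subsection \<open>The lattice\<close>

lemma Y_E:
  fixes y :: "int vec"
  assumes "y \<in> Y"
  obtains n :: "int vec" where "n \<in> carrier_vec s" "n $ v0 = n0" "\<And>i. i < s \<Longrightarrow> y $ i = 2 * n $ i + b $ i"
proof -
  obtain n :: "int vec" where n: "n \<in> carrier_vec s" "n $ v0 = n0" "y = 2 \<cdot>\<^sub>v n + b"
    using assms unfolding Y_def by blast
  then have "y $ i = 2 * n $ i + b $ i" if "i < s" for i
    using that b(1) by simp
  with n show ?thesis using that by blast
qed

lemma Y_v0: "(y :: int vec) \<in> Y \<Longrightarrow> y $ v0 = 2 * n0"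
  using v0 b(2) by (elim Y_E) simp

lemma Y_nmap:
  fixes n :: "int vec"
  assumes "\<And>i. i < s \<Longrightarrow> y i = 2 * n $ i + b $ i" "i < s"
  shows "nmap \<Gamma>m y i = 2 * nmap \<Gamma>m (($) n) i + nmap \<Gamma>m (($) b) i"
proof -
  have "nmap \<Gamma>m y i = nmap \<Gamma>m (\<lambda>i. 2 * n $ i + b $ i) i"
    by (rule nmap_cong[OF graph]) (simp_all add: assms)
  then show ?thesis by (simp add: nmap_add nmap_scale)
qed

lemma odd_nmap_Y:
  fixes y :: "int vec"
  assumes "y \<in> Y"
  shows "odd (nmap \<Gamma>m (($) y) v0)"
proof -
  obtain n :: "int vec" where "\<And>i. i < s \<Longrightarrow> y $ i = 2 * n $ i + b $ i" using Y_E[OF assms] by metis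
  then have "nmap \<Gamma>m (($) y) v0 = 2 * nmap \<Gamma>m (($) n) v0 + nmap \<Gamma>m (($) b) v0"
    using v0 by (rule Y_nmap)
  moreover have "even (am $ v0 - int (deg \<Gamma>m v0))"
    using am_spinc v0 unfolding spinc_vec_def by blast
  then have "odd (nmap \<Gamma>m (($) b) v0)"
    by (simp only: am_nth[OF v0] deg_v0) simp
  ultimately show ?thesis by simp
qed

text \<open>Modulo 2 the right-hand side counts the ends of the chain at which \<open>j\<close>
  sits, and the degree counts its neighbours; together they make 2.\<close>

lemma even_chain:
  assumes "odd m" "\<theta> \<in> {1, - 1 :: int}" "j < t"
  shows "even ((if j = t - 1 then kappa * \<theta> else 0) + (if j = 0 then m else 0) - ap $ j)"
proof -
  have "odd kappa" using kappa_square by (metis even_mult_iff odd_one)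
  then have "odd (kappa * \<theta>)" using assms(2) by auto
  moreover have "even (ap $ j - int (deg L j))"
    using label assms(3) by (simp add: torus_label_def spinc_vec_def)
  moreover have "deg L j = of_bool (0 < j) + of_bool (j \<noteq> t - 1)"
    using assms(3) by (auto simp: deg_linear)
  ultimately show ?thesis using assms(1) by (cases "j = 0"; cases "j = t - 1") auto
qed

definition torus_sol :: "nat \<Rightarrow> real" where
  "torus_sol = ($) (minv (lmat L) *\<^sub>v rvec ap)"

lemma nmap_torus_sol: "j < t \<Longrightarrow> nmap L torus_sol j = of_int (ap $ j)"
  using minv_L_solves[of "rvec ap" j] ap_carrier by (simp add: torus_sol_def)

lemma a_eq: "a = of_int p / 2 * torus_sol 0"
  using label by (simp add: torus_label_def torus_sol_def)

text \<open>Membership means that the preimage \<open>X\<close> of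
  \<open>h (y, \<theta>) - avec\<close> is even. At the merged vertex \<open>X\<close> equals
  \<open>x' 0\<close>, and \<open>p * x' 0 / 2\<close> is \<open>r * u - a\<close>, so the Laplace
  condition is evenness there. Evenness elsewhere follows from it.\<close>

lemma h_in_\<Lambda>_iff:
  fixes y :: "int vec"
  assumes y: "y \<in> Y" and \<theta>: "\<theta> \<in> {1, - 1}"
  shows "h (y, \<theta>) \<in> \<Lambda> \<longleftrightarrow> pair_exp (y, \<theta>) \<in> laplace_index p r a"
proof -
  define m where "m = nmap \<Gamma>m (($) y) v0"
  define f where "f = (\<lambda>j. (if j = t - 1 then kappa * \<theta> else 0) + (if j = 0 then m else 0))"
  obtain x :: "nat \<Rightarrow> real" where x: "\<And>j. j < t \<Longrightarrow> nmap L x j = of_int (f j)"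
    using chain_exists[of "\<lambda>j. of_int (f j)"] by blast
  have x0: "of_int p * x 0 = of_int \<theta> + of_int r * of_int m"
    by (rule chain_first) (auto simp: x f_def)
  define x' where "x' = (\<lambda>j. x j - torus_sol j)"
  have x': "nmap L x' j = of_int (f j - ap $ j)" if "j < t" for j
    using x[OF that] nmap_torus_sol[OF that] by (simp add: x'_def nmap_diff)
  \<comment> \<open>The sum of \<open>y\<close> and \<open>b\<close> appears because
    \<open>h\<close> is conjugated on this side while \<open>avec\<close> is not.\<close>
  define X where "X = lift (\<lambda>i. real_of_int (y $ i) + real_of_int (b $ i)) x'"
  have sum_nmap: "nmap \<Gamma>m (\<lambda>i. real_of_int (y $ i) + real_of_int (b $ i)) i =
      of_int (nmap \<Gamma>m (($) y) i) + of_int (nmap \<Gamma>m (($) b) i)" for i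
    by (simp only: nmap_of_int nmap_add)
  have X: "nmap \<Gamma> X i = of_int (h (y, \<theta>) $ i - avec $ i)" if "i < nv \<Gamma>" for i
    using that
  proof (cases i rule: glue_exhaust)
    case 1
    then show ?thesis
      using that by (simp add: X_def nmap_lift_left sum_nmap h_nth h_entry_left avec_left)
  next
    case (2 j)
    then show ?thesis
      using that by (simp add: X_def nmap_lift_right sum_nmap h_nth h_entry_right avec_right x' f_def m_def)
  qed
  have "pair_exp (y, \<theta>) \<in> laplace_index p r a \<longleftrightarrow> (\<exists>k::int. of_int p * (x' 0 / 2) = real_of_int (p * k))"
  proof -
    have "of_int r * fst (pair_exp (y, \<theta>)) - a = of_int p * (x' 0 / 2)"
      using x0 r mult_nth[OF y v0]
      by (simp add: pair_exp_def FK_exp_def a_eq x'_def m_def field_simps)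
    then show ?thesis by (simp only: laplace_index_def case_prod_beta mem_Collect_eq)
  qed
  also have "\<dots> \<longleftrightarrow> (\<exists>k::int. x' 0 = 2 * of_int k)"
    using p by auto
  also have "\<dots> \<longleftrightarrow> h (y, \<theta>) \<in> \<Lambda>"
  proof
    assume "h (y, \<theta>) \<in> \<Lambda>"
    then obtain n :: "int vec" where n: "n \<in> carrier_vec (nv \<Gamma>)" "h (y, \<theta>) = 2 \<cdot>\<^sub>v (lmat \<Gamma> *\<^sub>v n) + avec"
      unfolding \<Lambda>_def by blast
    define l where "l = h (y, \<theta>) - avec"
    have l: "l \<in> carrier_vec (nv \<Gamma>)" using h_carrier avec_carrier by (simp add: l_def)
    have l_nth: "l $ i = h (y, \<theta>) $ i - avec $ i" if "i < nv \<Gamma>" for i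
      using that avec_carrier by (simp add: l_def)
    have "nmap \<Gamma> (\<lambda>i. of_int (2 * n $ i)) i = real_of_int (l $ i)" if "i < nv \<Gamma>" for i
    proof -
      have "h (y, \<theta>) $ i = 2 * nmap \<Gamma> (($) n) i + avec $ i"
        using that n avec_carrier lmat_carrier[of \<Gamma>] lmat_mult_vec[OF plumbing_graph_glue that n(1)]
        by (simp del: index_mult_mat_vec)
      then show ?thesis by (simp only: nmap_of_int nmap_scale l_nth[OF that])
    qed
    \<comment> \<open>Both \<open>2 * n\<close> and \<open>X\<close> are preimages of
      \<open>l\<close>, so uniqueness identifies them at the merged vertex.\<close>
    then have "(minv (lmat \<Gamma>) *\<^sub>v rvec l) $ g 0 = of_int (2 * n $ g 0)"
      using right_less[OF t_pos] by (intro minv_\<Gamma>_nth[OF l])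
    moreover have "(minv (lmat \<Gamma>) *\<^sub>v rvec l) $ g 0 = X (g 0)"
      using right_less[OF t_pos] X by (intro minv_\<Gamma>_nth[OF l]) (simp_all only: l_nth)
    moreover have "X (g 0) = x' 0" unfolding X_def by (rule lift_g)
    ultimately show "\<exists>k::int. x' 0 = 2 * of_int k"
      by (intro exI[of _ "n $ g 0"]) (simp only: of_int_mult of_int_numeral)
  next
    assume "\<exists>k::int. x' 0 = 2 * of_int k"
    then have 0: "x' 0 \<in> range (\<lambda>k::int. 2 * of_int k)" by blast
    have "x' j \<in> range (\<lambda>k::int. 2 * of_int k)" if "j < t" for j
    proof (rule linear_closed[where x = x' and j = j and ks = ks, OF _ _ 0 _ that])
      fix u v :: real
      assume "u \<in> range (\<lambda>k::int. 2 * of_int k)" "v \<in> range (\<lambda>k::int. 2 * of_int k)"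
      then obtain k l :: int where "u = 2 * of_int k" "v = 2 * of_int l" by blast
      then have "u - v = 2 * of_int (k - l)" by simp
      then show "u - v \<in> range (\<lambda>k::int. 2 * of_int k)" by blast
    next
      fix k and u :: real
      assume "u \<in> range (\<lambda>k::int. 2 * of_int k)"
      then obtain l :: int where "u = 2 * of_int l" by blast
      then have "of_int k * u = 2 * of_int (k * l)" by simp
      then show "of_int k * u \<in> range (\<lambda>k::int. 2 * of_int k)" by blast
    next
      fix j assume j: "j < t"
      have "even (f j - ap $ j)"
        unfolding f_def by (rule even_chain[OF _ \<theta> j]) (simp add: m_def odd_nmap_Y[OF y])
      then obtain k where "f j - ap $ j = 2 * k" by (rule evenE)
      then have "nmap L x' j = 2 * of_int k" using x'[OF j] by simp
      then show "nmap L x' j \<in> range (\<lambda>k::int. 2 * of_int k)" by blast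
    qed
    then have "\<forall>j. \<exists>k::int. j < t \<longrightarrow> x' j = 2 * of_int k" by blast
    then obtain X' :: "nat \<Rightarrow> int" where X': "\<And>j. j < t \<Longrightarrow> x' j = 2 * of_int (X' j)"
      by metis
    obtain n :: "int vec" where n: "n \<in> carrier_vec s" "\<And>i. i < s \<Longrightarrow> y $ i = 2 * n $ i + b $ i"
      using Y_E[OF y] by metis
    \<comment> \<open>Since \<open>y = 2 * n + b\<close>, the sum of \<open>y\<close> and
      \<open>b\<close> is twice \<open>n + b\<close>; this halves \<open>X\<close> on the side of
      \<open>\<Gamma>m\<close>.\<close>
    define N where "N = lift (\<lambda>i. n $ i + b $ i) X'"
    have "X i = 2 * of_int (N i)" if "i < nv \<Gamma>" for i
    proof (cases "i < s")
      case True
      then show ?thesis using X'[OF t_pos] n(2)[OF True] n(2)[OF v0]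
        by (simp add: X_def N_def lift_def algebra_simps)
    next
      case False
      then have "i + 1 - s < t" using that unfolding nv_glue nv_linear by linarith
      then show ?thesis using X'[of "i + 1 - s"] False by (simp add: X_def N_def lift_def)
    qed
    then have "nmap \<Gamma> X i = of_int (2 * nmap \<Gamma> N i)" if "i < nv \<Gamma>" for i
      using nmap_cong[OF plumbing_graph_glue that, of X "\<lambda>i. 2 * of_int (N i)"]
      by (simp add: nmap_scale nmap_of_int)
    then have hN: "h (y, \<theta>) $ i - avec $ i = 2 * nmap \<Gamma> N i" if "i < nv \<Gamma>" for i
      using X[OF that] that by (simp only: of_int_eq_iff)
    have "h (y, \<theta>) = 2 \<cdot>\<^sub>v (lmat \<Gamma> *\<^sub>v vec (nv \<Gamma>) N) + avec"
    proof (rule eq_vecI)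
      fix i assume "i < dim_vec (2 \<cdot>\<^sub>v (lmat \<Gamma> *\<^sub>v vec (nv \<Gamma>) N) + avec)"
      then have i: "i < nv \<Gamma>" using avec_carrier by simp
      have "(lmat \<Gamma> *\<^sub>v vec (nv \<Gamma>) N) $ i = nmap \<Gamma> N i"
        using i nmap_cong[OF plumbing_graph_glue i, of "($) (vec (nv \<Gamma>) N)" N]
        by (subst lmat_mult_vec[OF plumbing_graph_glue i]) simp_all
      then show "h (y, \<theta>) $ i = (2 \<cdot>\<^sub>v (lmat \<Gamma> *\<^sub>v vec (nv \<Gamma>) N) + avec) $ i"
        using hN[OF i] i avec_carrier lmat_carrier[of \<Gamma>] by (simp del: index_mult_mat_vec)
    qed (use avec_carrier h_carrier[of y \<theta>] in simp)
    then show "h (y, \<theta>) \<in> \<Lambda>"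
      unfolding \<Lambda>_def by (intro CollectI exI[of _ "vec (nv \<Gamma>) N"] conjI vec_carrier)
  qed
  finally show ?thesis by blast
qed

lemma h_surj:
  fixes l :: "int vec"
  assumes l: "l \<in> \<Lambda>" and contour: "contour \<Gamma> {..<nv \<Gamma>} l \<noteq> 0"
  shows "l \<in> h ` (Y \<times> {1, - 1})"
proof -
  obtain n' :: "int vec" where n': "n' \<in> carrier_vec (nv \<Gamma>)" "l = 2 \<cdot>\<^sub>v (lmat \<Gamma> *\<^sub>v n') + avec"
    using l unfolding \<Lambda>_def by blast
  have dim: "dim_vec l = nv \<Gamma>" using n' avec_carrier by simp
  have l_nth: "l $ i = 2 * nmap \<Gamma> (($) n') i + avec $ i" if "i < nv \<Gamma>" for i
    using that n' avec_carrier lmat_carrier[of \<Gamma>] lmat_mult_vec[OF plumbing_graph_glue that n'(1)]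
    by (simp del: index_mult_mat_vec)
  \<comment> \<open>\<open>kappa\<close> is its own inverse, so this undoes the factor
    \<open>kappa\<close> in \<open>h\<close>.\<close>
  define \<theta> where "\<theta> = kappa * l $ g (t - 1)"
  have "l $ g (t - 1) \<in> {1, - 1}"
    using contour_nonzero[OF contour, of "t - 1"] t_pos by simp
  moreover have "kappa \<in> {1, - 1}"
    using p by (auto simp: kappa_def sgn_if minus_one_power_iff)
  ultimately have \<theta>: "\<theta> \<in> {1, - 1}" unfolding \<theta>_def by auto
  have \<theta>l: "kappa * \<theta> = l $ g (t - 1)"
    unfolding \<theta>_def by (simp only: mult.assoc[symmetric] kappa_square mult_1)
  \<comment> \<open>Up to the kernel, \<open>y\<close> must be \<open>- (b + 2 * n')\<close>. The
    multiple of \<open>lam\<close> changes no row and moves the entry of \<open>n\<close> at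
    \<open>v0\<close> to the prescribed \<open>n0\<close>.\<close>
  define n where "n = vec s (\<lambda>i. - (b $ i + n' $ i) + (n0 + n' $ v0) * lam i)"
  define y where "y = 2 \<cdot>\<^sub>v n + b"
  have "y \<in> Y"
    unfolding Y_def y_def using v0 b(2) lam(1) by (intro CollectI exI[of _ n]) (simp add: n_def)
  have "nmap \<Gamma>m (($) y) i = - (nmap \<Gamma>m (($) b) i + 2 * nmap \<Gamma>m (($) n') i)" if "i < s" for i
  proof -
    have "nmap \<Gamma>m (($) y) i =
        nmap \<Gamma>m (\<lambda>i. 2 * (n0 + n' $ v0) * lam i - (b $ i + 2 * n' $ i)) i"
      using b(1) by (intro nmap_cong[OF graph that]) (simp add: y_def n_def algebra_simps)
    then show ?thesis
      using lam(2)[OF that] by (simp add: nmap_diff nmap_add nmap_scale)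
  qed
  then have left: "h_entry (($) y) \<theta> i = l $ i" if "i < s" "i \<noteq> v0" for i
    using that by (simp add: h_entry_left l_nth left_less nmap_left avec_left)
  have "h (y, \<theta>) = l"
  proof (rule eq_vecI)
    fix i assume "i < dim_vec l"
    then have i: "i < nv \<Gamma>" using dim by simp
    then show "h (y, \<theta>) $ i = l $ i"
    proof (cases i rule: glue_exhaust)
      case 1
      then show ?thesis using i left by (simp add: h_nth)
    next
      case (2 j)
      then show ?thesis
        using i contour_nonzero[OF contour, of j] \<theta>l by (simp add: h_nth h_entry_right split: if_splits)
    qed
  qed (use dim h_carrier[of y \<theta>] in simp)
  with \<open>y \<in> Y\<close> \<theta> show ?thesis by blast
qed

text \<open>The end of the chain determines \<theta>. The fixed value at \<open>v0\<close> excludes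
  the kernel direction, so \<open>vanish\<close> applies to the difference of the two
  vectors.\<close>

lemma inj_h: "inj_on h (Y \<times> {1, - 1})"
proof (rule inj_onI, clarify)
  fix y y' :: "int vec" and \<theta> \<theta>'
  assume y: "y \<in> Y" "y' \<in> Y" and eq: "h (y, \<theta>) = h (y', \<theta>')"
  have h_entry: "h_entry (($) y) \<theta> i = h_entry (($) y') \<theta>' i" if "i < nv \<Gamma>" for i
    using arg_cong[OF eq, of "\<lambda>l :: int vec. l $ i"] that by (simp add: h_nth)
  have "kappa * \<theta> = kappa * \<theta>'"
    using h_entry[of "g (t - 1)"] right_less[of "t - 1"] t_pos by (simp add: h_entry_right)
  moreover have "kappa \<noteq> 0" using kappa_square by force
  ultimately have "\<theta> = \<theta>'" by simp
  have "y $ i - y' $ i = 0" if "i < s" for i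
  proof (rule vanish[OF _ _ that])
    show "y $ v0 - y' $ v0 = 0" using y by (simp add: Y_v0)
    show "nmap \<Gamma>m (\<lambda>i. y $ i - y' $ i) i = 0" if "i < s" "i \<noteq> v0" for i
      using h_entry[of i] left_less[of i] that by (simp add: nmap_diff h_entry_left)
  qed
  then have "y = y'"
    using Y_carrier[OF y(1)] Y_carrier[OF y(2)] by (intro eq_vecI) auto
  with \<open>\<theta> = \<theta>'\<close> show "y = y' \<and> \<theta> = \<theta>'" by simp
qed

subsection \<open>Finiteness\<close>

text \<open>Vertices of degree at least 3 carry a positive form, and the contour bounds the entries
  at all others.\<close>

lemma finite_quad:
  "finite {l \<in> carrier_vec (nv \<Gamma>). contour \<Gamma> {..<nv \<Gamma>} l \<noteq> 0 \<and> quad l = E}"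
proof -
  define T where "T = {v. v < nv \<Gamma> \<and> deg \<Gamma> v \<ge> 3}"
  define S where "S = {v. v < nv \<Gamma> \<and> deg \<Gamma> v < 3}"
  define A where "A = (\<lambda>u v. - minv (lmat \<Gamma>) $$ (u, v))"
  have minv: "minv (lmat \<Gamma>) \<in> carrier_mat (nv \<Gamma>) (nv \<Gamma>)"
    by (rule minv(1)[OF lmat_carrier det_\<Gamma>])
  have union: "S \<union> T = {..<nv \<Gamma>}" by (auto simp: S_def T_def)
  have ST: "finite S" "finite T" "S \<inter> T = {}" by (auto simp: S_def T_def)
  have form: "x \<bullet> (minv (lmat \<Gamma>) *\<^sub>v x) = - qform {..<nv \<Gamma>} A (($) x)" if "x \<in> carrier_vec (nv \<Gamma>)" for x
    using that minv
    by (simp add: scalar_prod_def qform_def A_def sum_distrib_left sum_negf lessThan_atLeast0 mult_ac)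
  have pos: "qform T A x > 0" if x: "\<forall>v. v \<notin> T \<longrightarrow> x v = 0" "\<exists>v. x v \<noteq> 0" for x
  proof -
    let ?x = "vec (nv \<Gamma>) x"
    obtain v where v: "x v \<noteq> 0" using x(2) by blast
    then have "v < nv \<Gamma>" using x(1) by (auto simp: T_def)
    with v have "?x \<noteq> 0\<^sub>v (nv \<Gamma>)" by (metis index_vec index_zero_vec(1))
    then have "?x \<bullet> (minv (lmat \<Gamma>) *\<^sub>v ?x) < 0"
      using weak x(1) minv unfolding weakly_negative_definite_def neg_def_on_def T_def by auto
    then have "0 < qform {..<nv \<Gamma>} A (($) ?x)" by (simp add: form)
    also have "qform {..<nv \<Gamma>} A (($) ?x) = qform {..<nv \<Gamma>} A x"
      by (rule qform_cong) simp
    also have "\<dots> = qform T A x"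
    proof -
      have "(\<Sum>v<nv \<Gamma>. A u v * x u * x v) = (\<Sum>v\<in>T. A u v * x u * x v)" for u
        using x(1) by (intro sum.mono_neutral_right) (auto simp: T_def)
      then show ?thesis
        unfolding qform_def using x(1) by (simp only:) (intro sum.mono_neutral_right, auto simp: T_def)
    qed
    finally show ?thesis .
  qed
  let ?F = "{x :: nat \<Rightarrow> int. (\<forall>v. v \<notin> S \<union> T \<longrightarrow> x v = 0) \<and> (\<forall>v\<in>S. \<bar>x v\<bar> \<le> 2) \<and>
    qform (S \<union> T) A (\<lambda>v. of_int (x v)) + (\<Sum>v\<in>S \<union> T. 0 * of_int (x v)) \<le> - E}"
  let ?f = "\<lambda>l v. if v < nv \<Gamma> then (l :: int vec) $ v else 0"
  have fin: "finite ?F"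
    by (rule finite_qform_le_bounded[OF ST pos])
  show ?thesis
  proof (rule finite_imageD)
    show "finite (?f ` {l \<in> carrier_vec (nv \<Gamma>). contour \<Gamma> {..<nv \<Gamma>} l \<noteq> 0 \<and> quad l = E})"
    proof (rule finite_subset[OF _ fin], rule image_subsetI)
      fix l assume "l \<in> {l \<in> carrier_vec (nv \<Gamma>). contour \<Gamma> {..<nv \<Gamma>} l \<noteq> 0 \<and> quad l = E}"
      then have l: "l \<in> carrier_vec (nv \<Gamma>)" "contour \<Gamma> {..<nv \<Gamma>} l \<noteq> 0" "quad l = E" by auto
      \<comment> \<open>The bound is the largest exponent \<open>2 - deg\<close>, attained at an
        isolated vertex.\<close>
      have "\<bar>?f l v\<bar> \<le> 2" if "v \<in> S" for v
      proof (rule ccontr)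
        assume "\<not> \<bar>?f l v\<bar> \<le> 2"
        then have "pv_coeff (2 - int (deg \<Gamma> v)) (- (l $ v)) = 0"
          using that by (intro pv_coeff_eq_0) (auto simp: S_def split: if_splits)
        then have "contour \<Gamma> {..<nv \<Gamma>} l = 0"
          unfolding contour_def using that by (intro prod_zero) (auto simp: S_def)
        with l(2) show False by simp
      qed
      moreover have "qform {..<nv \<Gamma>} A (\<lambda>v. of_int (?f l v)) = - E"
      proof -
        have "qform {..<nv \<Gamma>} A (\<lambda>v. of_int (?f l v)) = qform {..<nv \<Gamma>} A (($) (rvec l))"
          using l(1) by (intro qform_cong) simp
        then show ?thesis using form[of "rvec l"] l(1,3) by (simp add: quad_def)
      qed
      ultimately show "?f l \<in> ?F" unfolding union by simp
    qed
    show "inj_on ?f {l \<in> carrier_vec (nv \<Gamma>). contour \<Gamma> {..<nv \<Gamma>} l \<noteq> 0 \<and> quad l = E}"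
    proof (rule inj_onI)
      fix l l' :: "int vec"
      assume l: "l \<in> {l \<in> carrier_vec (nv \<Gamma>). contour \<Gamma> {..<nv \<Gamma>} l \<noteq> 0 \<and> quad l = E}"
        "l' \<in> {l \<in> carrier_vec (nv \<Gamma>). contour \<Gamma> {..<nv \<Gamma>} l \<noteq> 0 \<and> quad l = E}" and eq: "?f l = ?f l'"
      have "l $ v = l' $ v" if "v < nv \<Gamma>" for v
        using fun_cong[OF eq, of v] that by simp
      then show "l = l'" using l by (intro eq_vecI) auto
    qed
  qed
qed

section \<open>Comparison of the two formal sums\<close>

definition pair_coeff :: "int vec \<times> int \<Rightarrow> rat" where
  "pair_coeff = (\<lambda>(y, \<theta>). of_int \<theta> * FK_coeff y)"

lemma pair_coefficient:
  assumes "i \<in> Y \<times> {1, - 1}"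
  shows "(- 1) ^ pos_count (lmat \<Gamma>) * contour \<Gamma> {..<nv \<Gamma>} (h i) = \<epsilon> * pair_coeff i"
  using assms coefficient by (auto simp: pair_coeff_def)

lemma pair_exponent:
  assumes "i \<in> Y \<times> {1, - 1}"
  shows "prefactor_exp \<Gamma> - quad (h i) / 4 = shift + laplace_exp p r (pair_exp i)"
  using assms exponent by auto

lemma contour_h_nonzero:
  assumes "i \<in> Y \<times> {1, - 1}"
  shows "contour \<Gamma> {..<nv \<Gamma>} (h i) \<noteq> 0 \<longleftrightarrow> pair_coeff i \<noteq> 0"
  using pair_coefficient[OF assms] \<epsilon>_sign by auto

text \<open>A fixed exponent on the knot side fixes the form on the image under the injective
  \<open>h\<close>, where finiteness is known.\<close>

lemma finite_pair: "finite {i \<in> Y \<times> {1, - 1}. pair_coeff i \<noteq> 0 \<and> laplace_exp p r (pair_exp i) = e}" (is "finite ?I")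
proof (rule finite_imageD)
  show "inj_on h ?I" using inj_h by (rule inj_on_subset) auto
  let ?E = "4 * (prefactor_exp \<Gamma> - shift - e)"
  have "h ` ?I \<subseteq> {l \<in> carrier_vec (nv \<Gamma>). contour \<Gamma> {..<nv \<Gamma>} l \<noteq> 0 \<and> quad l = ?E}"
  proof (rule image_subsetI)
    fix i assume i: "i \<in> ?I"
    then have "quad (h i) = ?E" using pair_exponent[of i] by auto
    moreover have "h i \<in> carrier_vec (nv \<Gamma>)" using h_carrier by (cases i) simp
    ultimately show "h i \<in> {l \<in> carrier_vec (nv \<Gamma>). contour \<Gamma> {..<nv \<Gamma>} l \<noteq> 0 \<and> quad l = ?E}"
      using contour_h_nonzero[of i] i by blast
  qed
  then show "finite (h ` ?I)" using finite_quad by (rule finite_subset)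
qed

lemma FK_eq: "FK \<Gamma>m v0 b n0 = fsum Y FK_coeff FK_exp"
  unfolding FK_def Y_def FK_coeff_def FK_exp_def ..

lemma FK_summable: "fsummable Y FK_coeff FK_exp"
  unfolding fsummable_def
proof
  fix e
  \<comment> \<open>The exponent of \<open>q\<close> to which the term \<theta> = 1 sends the whole
    fibre over \<open>e\<close>.\<close>
  let ?e = "laplace_exp p r (fst e + 1 / (2 * real_of_int r), snd e)"
  have "(\<lambda>y. (y, 1)) ` {y \<in> Y. FK_coeff y \<noteq> 0 \<and> FK_exp y = e} \<subseteq>
      {i \<in> Y \<times> {1, - 1}. pair_coeff i \<noteq> 0 \<and> laplace_exp p r (pair_exp i) = ?e}"
    by (auto simp: pair_coeff_def pair_exp_def)
  then have "finite ((\<lambda>y. (y, 1 :: int)) ` {y \<in> Y. FK_coeff y \<noteq> 0 \<and> FK_exp y = e})"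
    using finite_pair by (rule finite_subset)
  then show "finite {y \<in> Y. FK_coeff y \<noteq> 0 \<and> FK_exp y = e}"
    by (rule finite_imageD) (simp add: inj_on_def)
qed

lemma xdiff_eq: "xdiff_mult (1 / (2 * real_of_int r)) (FK \<Gamma>m v0 b n0) = fsum (Y \<times> {1, - 1}) pair_coeff pair_exp"
  unfolding FK_eq xdiff_mult_fsum[OF FK_summable] pair_coeff_def pair_exp_def ..

lemma finite_pair_index:
  "finite {i \<in> Y \<times> {1, - 1}. pair_coeff i \<noteq> 0 \<and> pair_exp i \<in> laplace_index p r a \<and> laplace_exp p r (pair_exp i) = e}"
  by (rule finite_subset[OF _ finite_pair[of e]]) blast

text \<open>A nonzero contour gives surjectivity, and \<open>h_in_\<Lambda>_iff\<close> matches the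
  class with the support of the Laplace transform.\<close>

lemma h_bij:
  "bij_betw h {i \<in> {i \<in> Y \<times> {1, - 1}. pair_exp i \<in> laplace_index p r a}. pair_coeff i \<noteq> 0}
    {l \<in> \<Lambda>. (- 1) ^ pos_count (lmat \<Gamma>) * contour \<Gamma> {..<nv \<Gamma>} l \<noteq> 0}" (is "bij_betw h ?I ?J")
proof (rule bij_betw_imageI)
  show "inj_on h ?I" using inj_h by (rule inj_on_subset) auto
  have mem: "h i \<in> \<Lambda> \<longleftrightarrow> pair_exp i \<in> laplace_index p r a" if "i \<in> Y \<times> {1, - 1}" for i
    using h_in_\<Lambda>_iff that by (cases i) auto
  show "h ` ?I = ?J"
  proof
    show "h ` ?I \<subseteq> ?J" using mem contour_h_nonzero by auto
    show "?J \<subseteq> h ` ?I"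
    proof
      fix l assume l: "l \<in> ?J"
      then have "l \<in> h ` (Y \<times> {1, - 1})" using h_surj by auto
      then obtain i where "i \<in> Y \<times> {1, - 1}" "l = h i" by blast
      with l show "l \<in> h ` ?I" using mem contour_h_nonzero[of i] by auto
    qed
  qed
qed

lemma Zhat_eq:
  "Zhat \<Gamma> avec = (\<lambda>e. \<epsilon> * qpow_mult shift
    (laplace p r a (xdiff_mult (1 / (2 * real_of_int r)) (FK \<Gamma>m v0 b n0))) e)"
proof -
  have "laplace p r a (xdiff_mult (1 / (2 * real_of_int r)) (FK \<Gamma>m v0 b n0)) =
      fsum {i \<in> Y \<times> {1, - 1}. pair_exp i \<in> laplace_index p r a} pair_coeff (laplace_exp p r \<circ> pair_exp)"
    unfolding laplace_def xdiff_eq by (rule fsum_fsum(2)[OF finite_pair_index])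
  moreover have "Zhat \<Gamma> avec = fsum \<Lambda> (\<lambda>l. (- 1) ^ pos_count (lmat \<Gamma>) * contour \<Gamma> {..<nv \<Gamma>} l)
      (\<lambda>l. prefactor_exp \<Gamma> - quad l / 4)"
    unfolding Zhat_def \<Lambda>_def quad_def ..
  moreover have "fsum \<Lambda> (\<lambda>l. (- 1) ^ pos_count (lmat \<Gamma>) * contour \<Gamma> {..<nv \<Gamma>} l)
      (\<lambda>l. prefactor_exp \<Gamma> - quad l / 4) =
      (\<lambda>e. \<epsilon> * qpow_mult shift
        (fsum {i \<in> Y \<times> {1, - 1}. pair_exp i \<in> laplace_index p r a} pair_coeff (laplace_exp p r \<circ> pair_exp)) e)"
    by (rule fsum_reindex[OF h_bij]) (use pair_coefficient pair_exponent in auto)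
  ultimately show ?thesis by simp
qed

lemma laplace_defined_xdiff:
  "laplace_defined p r a (xdiff_mult (1 / (2 * real_of_int r)) (FK \<Gamma>m v0 b n0))"
  unfolding laplace_defined_def xdiff_eq by (rule fsum_fsum(1)[OF finite_pair_index])

text \<open>The representative is the image of a glued vector as well, with \<open>- b\<close> in
  place of \<open>y\<close>, so its form splits in the same way.\<close>

lemma quad_avec:
  "quad avec = real_of_int (b \<bullet> (lmat \<Gamma>m *\<^sub>v b)) + rvec ap \<bullet> (minv (lmat L) *\<^sub>v rvec ap)"
proof -
  let ?b = "\<lambda>i. - real_of_int (b $ i)"
  have nb: "nmap \<Gamma>m ?b i = - of_int (nmap \<Gamma>m (($) b) i)" for i
    by (simp only: nmap_minus nmap_of_int)
  have X: "nmap \<Gamma> (lift ?b torus_sol) i = real_of_int (avec $ i)" if "i < nv \<Gamma>" for i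
    using that
  proof (cases i rule: glue_exhaust)
    case 1
    then show ?thesis by (simp add: nmap_lift_left nb avec_left)
  next
    case (2 j)
    then show ?thesis by (simp add: nmap_lift_right nb avec_right nmap_torus_sol)
  qed
  have "quad avec = (\<Sum>i<s. ?b i * nmap \<Gamma>m ?b i) + (\<Sum>j<t. torus_sol j * nmap L torus_sol j)"
    using quad_eq[OF avec_carrier X] by (simp only: lift_pairing)
  also have "(\<Sum>i<s. ?b i * nmap \<Gamma>m ?b i) = real_of_int (\<Sum>i<s. b $ i * am $ i)"
    by (simp add: nb am_nth del: index_mult_mat_vec)
  also have "(\<Sum>i<s. b $ i * am $ i) = b \<bullet> am"
    by (simp only: scalar_prod_def dim_am lessThan_atLeast0)
  also have "(\<Sum>j<t. torus_sol j * nmap L torus_sol j) = (\<Sum>j<t. of_int (ap $ j) * torus_sol j)"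
    by (simp add: nmap_torus_sol mult_ac)
  also have "\<dots> = rvec ap \<bullet> (minv (lmat L) *\<^sub>v rvec ap)"
  proof -
    have "minv (lmat L) \<in> carrier_mat t t"
      using minv(1)[OF lmat_carrier det_L] by simp
    then have "dim_vec (minv (lmat L) *\<^sub>v rvec ap) = t" by simp
    then show ?thesis
      unfolding scalar_prod_def torus_sol_def using ap_carrier
      by (simp add: lessThan_atLeast0 del: index_mult_mat_vec)
  qed
  finally show ?thesis .
qed

lemma shift_eq: "shift = xi \<Gamma> \<Gamma>m L avec b ap + alpha ks p r"
  using quad_avec by (simp add: shift_def xi_def quad_def)

lemma shift_rational: "shift \<in> \<rat>"
  unfolding shift_def alpha_def Ntt_def[symmetric] using Ntt_rational
  by (intro Rats_add Rats_diff Rats_mult Rats_divide Rats_of_int Rats_number_of Rats_1)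

end

theorem theorem1p2:
  fixes \<Gamma>m \<Gamma>p \<Gamma> :: plumbing and v0 :: nat and b am ap :: "int vec" and n0 :: int
    and p r :: int and ks :: "int list" and a :: real
  assumes "plumbing_tree \<Gamma>m" and "v0 < nv \<Gamma>m" and "deg \<Gamma>m v0 = 1"
    and "negative_definite (remove_vertex \<Gamma>m v0)"
    and "integer_homology_sphere (remove_vertex \<Gamma>m v0)"
    and "det (lmat \<Gamma>m) = 0"
    and "b \<in> carrier_vec (nv \<Gamma>m)" and "b $ v0 = 0"
    and "am = lmat \<Gamma>m *\<^sub>v b" and "spinc_vec \<Gamma>m am"
    and "p \<noteq> 0" and "r > 0" and "coprime p r"
    and "contfrac ks (real_of_int p / real_of_int r)"
    and "\<Gamma>p = linear_plumbing ks"
    and "\<Gamma> = glue \<Gamma>m v0 \<Gamma>p"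
    and "weakly_negative_definite \<Gamma>"
    and "a - (real_of_int r + 1) / 2 \<in> \<int>"
    and "torus_label ks p ap a"
  shows "laplace_defined p r a (xdiff_mult (1 / (2 * real_of_int r)) (FK \<Gamma>m v0 b n0)) \<and>
    (\<exists>\<epsilon> \<in> {1, - 1}. \<exists>d \<in> \<rat>.
       \<epsilon> = of_int (sgn p) * (- 1) powi (tau \<Gamma> \<Gamma>m \<Gamma>p + 1) \<and>
       d = xi \<Gamma> \<Gamma>m \<Gamma>p (glue_vec v0 am ap) b ap + alpha ks p r \<and>
       Zhat \<Gamma> (glue_vec v0 am ap) =
         (\<lambda>e. \<epsilon> * qpow_mult d (laplace p r a (xdiff_mult (1 / (2 * real_of_int r)) (FK \<Gamma>m v0 b n0))) e))"
proof -
  have graph: "plumbing_graph \<Gamma>m"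
    using assms(1) unfolding plumbing_tree_def plumbing_graph_def by blast
  interpret surgery \<Gamma>m v0 b ap n0 p r ks a
    using assms graph remove_vertex_solvable[OF graph] by unfold_locales simp_all
  have "avec = glue_vec v0 am ap" by (simp add: avec_def assms(9))
  then show ?thesis
    unfolding assms(15,16)
    using laplace_defined_xdiff Zhat_eq shift_eq shift_rational \<epsilon>_sign \<epsilon>_def by metis
qed

end
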